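(* Let $f(n,P_4)$ denote the maximum number of copies of $P_4$ (the path with $4$ edges and $5$ vertices) contained in a planar graph on $n$ vertices. Then $f(n,P_4)=n^3+O(n^2)$; that is, there is an absolute constant $C$ such that $|f(n,P_4)-n^3|\le Cn^2$ for all $n\ge 1$.
   Context: A copy of $P_4$ in a graph $G$ is a subgraph of $G$ isomorphic to $P_4$. The length of a path is its number of edges. *)

theory Defs
  imports "HOL-Analysis.Analysis"
begin

definition simple_graph :: "nat \<Rightarrow> nat set set \<Rightarrow> bool" where
  "simple_graph n E \<longleftrightarrow> (\<forall>e\<in>E. \<exists>u v. u \<noteq> v \<and> u < n \<and> v < n \<and> e = {u, v})"

definition planar :: "nat \<Rightarrow> nat set set \<Rightarrow> bool" where
  "planar n E \<longleftrightarrow>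
    (\<exists>(pos :: nat \<Rightarrow> real \<times> real) (curve :: nat set \<Rightarrow> real \<Rightarrow> real \<times> real).
      inj_on pos {0..<n} \<and>
      (\<forall>e\<in>E. arc (curve e) \<and> {pathstart (curve e), pathfinish (curve e)} = pos ` e \<and>
              path_image (curve e) \<inter> pos ` {0..<n} = pos ` e) \<and>
      (\<forall>e\<in>E. \<forall>e'\<in>E. e \<noteq> e' \<longrightarrow>
              path_image (curve e) \<inter> path_image (curve e') \<subseteq> pos ` (e \<inter> e')))"

text \<open>Copies of P_4 (path with 4 edges, 5 vertices) in the graph with edge set E;
  a copy is a subgraph, determined by its edge set.\<close>
definition P4_copies :: "nat set set \<Rightarrow> nat set set set" where
  "P4_copies E = {{{v0, v1}, {v1, v2}, {v2, v3}, {v3, v4}} | v0 v1 v2 v3 v4.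
      distinct [v0, v1, v2, v3, v4] \<and>
      {v0, v1} \<in> E \<and> {v1, v2} \<in> E \<and> {v2, v3} \<in> E \<and> {v3, v4} \<in> E}"

definition f_P4 :: "nat \<Rightarrow> nat" where
  "f_P4 n = Max {card (P4_copies E) | E. simple_graph n E \<and> planar n E}"

end

(*
  Upper bound.  K_{3,3} is not a minor of a plane graph: two branch sets on one side give a theta curve
  through the three branch sets of the other side, and the sixth branch set would be a connected set
  touching all three arcs of the theta curve, which Janiszewski's theorem forbids.  Hence every vertex
  subset W spans O(|W|) edges (otherwise contracting edges produces a K_6 minor) and any three vertices
  have at most two common neighbours.

  A copy of P_4 is determined by its second and fourth vertex u, v, a common neighbour of them and a
  neighbour of each, so twice the number of copies is at most the sum of d(u) d(v) c(u,v) over ordered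
  pairs, c being the codegree.  By sparsity, pairs involving a vertex of degree below eta n contribute
  O(eta n^3).  There are O(1) vertices of higher degree and all but O(1) vertices see at most two of them,
  so if d(u) d(v) <= (1 - delta) n^2 for all pairs then the sum is at most 2 n^3 + O(n^2).  Otherwise some
  a, b have all but t <= 2 delta n vertices as common neighbours; the pair (a,b) then loses 2 t n^2,
  every other vertex has at most two neighbours among these common neighbours, and the remaining
  contributions are at most O(n^2) + 2 t n^2.

  Lower bound: K_{2,n-2}, drawn with straight segments.
*)
theory Submission
  imports Defs
begin

section \<open>Theta curves and $K_{3,3}$ minors in the plane\<close>

text \<open>The error must be O(n^2), so near the extremal configuration losses and gains have to be
  compared exactly. With a dominating pair the loss is linear in t, while every gain beyond O(n^2)
  is at most 3400 n t^2; the bound t <= 2 \<delta> n then decides, and 1/3400 is the largest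
  \<delta> with which it does. Without such a pair, \<eta> = \<delta>/1024 limits the low degrees to
  2 \<delta> n^3, just what the factor 1 - \<delta> saves on the pairs of high degree. The edge
  bound 32 = 2^5 arises because the density demanded for a clique minor doubles with every further
  vertex, and K_6 contains K_{3,3}. Excluding K_{3,3} for connected sets instead of points lets one
  topological statement serve both the edge bound, through branch sets, and the bound on common
  neighbours, through single vertices.\<close>

text \<open>Let \<open>V\<close> be the side of the Jordan curve formed by \<open>g1\<close> and
  \<open>g2\<close> that misses \<open>Y\<close> and the open arc of \<open>g3\<close>. Crossing
  \<open>g1\<close> leads from \<open>V\<close> to \<open>Y\<close> off \<open>g2\<close> and
  \<open>g3\<close>; crossing \<open>g2\<close> does so off \<open>g1\<close> and \<open>g3\<close>.
  The two obstacles share just the connected set \<open>g3\<close>, so by Janiszewski their union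
  does not separate \<open>V\<close> from \<open>Y\<close>, although it contains the frontier of
  \<open>V\<close>. As \<open>Y\<close> avoids the arcs, it touches them through its
  closure.\<close>

lemma theta_curve_separation:
  fixes Y :: "complex set"
  assumes arcs: "arc g1" "arc g2" "arc g3"
    and ends: "pathstart g1 = a" "pathfinish g1 = b" "pathstart g2 = a" "pathfinish g2 = b"
      "pathstart g3 = a" "pathfinish g3 = b"
    and meet: "path_image g1 \<inter> path_image g2 = {a, b}" "path_image g1 \<inter> path_image g3 = {a, b}"
      "path_image g2 \<inter> path_image g3 = {a, b}"
    and Y: "connected Y" "Y \<inter> (path_image g1 \<union> path_image g2 \<union> path_image g3) = {}"
    and y1: "y1 \<in> closure Y" "y1 \<in> path_image g1 - {a, b}"
    and y2: "y2 \<in> closure Y" "y2 \<in> path_image g2 - {a, b}"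
    and y3: "y3 \<in> closure Y" "y3 \<in> path_image g3 - {a, b}"
  shows False
proof -
  let ?C = "path_image g1 \<union> path_image g2"
  let ?c = "g1 +++ reversepath g2"
  have sp: "simple_path ?c"
    using arcs ends meet(1) by (intro simple_path_join_loop) (auto simp: arc_reversepath)
  have loop: "pathfinish ?c = pathstart ?c"
    using ends by simp
  have pc: "path_image ?c = ?C"
    using ends by (simp add: path_image_join)
  obtain inner outer where J: "inner \<noteq> {}" "connected inner" "outer \<noteq> {}" "connected outer"
     "open inner" "open outer"
     "inner \<inter> outer = {}" "inner \<union> outer = - ?C" "frontier inner = ?C" "frontier outer = ?C"
    using Jordan_inside_outside[OF sp loop] unfolding pc by metis
  have open_arc: "connected (path_image g - {a, b})" if "arc g" "pathstart g = a" "pathfinish g = b" for g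
    using connected_simple_path_endless[OF arc_imp_simple_path[OF that(1)]] that by simp
  have Ypt: "connected (Y \<union> {y})" if "y \<in> closure Y" for y
    using that by (intro connected_intermediate_closure[OF Y(1)]) (auto simp: closure_def)
  have Yarc: "connected (Y \<union> (path_image g - {a, b}))"
    if "arc g" "pathstart g = a" "pathfinish g = b" "y \<in> closure Y" "y \<in> path_image g - {a, b}" for g y
  proof -
    have "connected ((Y \<union> {y}) \<union> (path_image g - {a, b}))"
      using that(5) by (intro connected_Un Ypt open_arc that(1-4)) auto
    moreover have "(Y \<union> {y}) \<union> (path_image g - {a, b}) = Y \<union> (path_image g - {a, b})"
      using that by auto
    ultimately show ?thesis by simp
  qed
  have Yne: "Y \<noteq> {}" using y1(1) by auto
  \<comment> \<open>Stated for either side, since the component containing \<open>Y\<close> may be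
    the inner or the outer one.\<close>
  have main: False
    if V: "V \<noteq> {}" "connected V" "V \<inter> U = {}" "V \<union> U = - ?C" "frontier V = ?C" "open V"
      and U: "Y \<union> (path_image g3 - {a, b}) \<subseteq> U" for U V
  proof -
    have Vcl: "closure V = V \<union> ?C"
      using V(5) closure_Un_frontier by blast
    have Vg: "connected (V \<union> (Y \<union> (path_image g - {a, b})))"
      if g: "arc g" "pathstart g = a" "pathfinish g = b" "y \<in> closure Y" "y \<in> path_image g - {a, b}"
        "path_image g \<subseteq> ?C" for g y
    proof -
      have "connected (V \<union> (path_image g - {a, b}))"
        using g(6) Vcl by (intro connected_intermediate_closure[OF V(2)]) auto
      then have "connected ((V \<union> (path_image g - {a, b})) \<union> (Y \<union> (path_image g - {a, b})))"
        using g(5) by (intro connected_Un[OF _ Yarc[OF g(1-5)]]) blast+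
      moreover have "(V \<union> (path_image g - {a, b})) \<union> (Y \<union> (path_image g - {a, b}))
          = V \<union> (Y \<union> (path_image g - {a, b}))" by auto
      ultimately show ?thesis by simp
    qed
    obtain x where x: "x \<in> V" using V(1) by auto
    obtain y where y: "y \<in> Y" using Yne by auto
    have ab: "a \<in> ?C" "b \<in> ?C" using meet(1) by auto
    have VC: "V \<inter> ?C = {}" using V(4) by auto
    have "path_image g3 \<subseteq> U \<union> {a, b}" using U by auto
    then have Vg3: "V \<inter> path_image g3 = {}" using V(3) VC ab by auto
    have c1: "connected_component (- (path_image g2 \<union> path_image g3)) x y"
      unfolding connected_component_def
    proof (intro exI conjI)
      show "connected (V \<union> (Y \<union> (path_image g1 - {a, b})))"
        using Vg[of g1 y1] arcs ends y1 by auto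
      show "V \<union> (Y \<union> (path_image g1 - {a, b})) \<subseteq> - (path_image g2 \<union> path_image g3)"
        using VC Vg3 Y(2) meet by auto
    qed (use x y in auto)
    have c2: "connected_component (- (path_image g1 \<union> path_image g3)) x y"
      unfolding connected_component_def
    proof (intro exI conjI)
      show "connected (V \<union> (Y \<union> (path_image g2 - {a, b})))"
        using Vg[of g2 y2] arcs ends y2 by auto
      show "V \<union> (Y \<union> (path_image g2 - {a, b})) \<subseteq> - (path_image g1 \<union> path_image g3)"
        using VC Vg3 Y(2) meet by auto
    qed (use x y in auto)
    have eq: "(path_image g2 \<union> path_image g3) \<inter> (path_image g1 \<union> path_image g3) = path_image g3"
      using meet by auto
    have "connected_component (- ((path_image g2 \<union> path_image g3) \<union> (path_image g1 \<union> path_image g3))) x y"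
    proof (rule Janiszewski[OF _ _ _ c1 c2])
      show "connected ((path_image g2 \<union> path_image g3) \<inter> (path_image g1 \<union> path_image g3))"
        unfolding eq using arcs(3) by (simp add: arc_imp_path connected_path_image)
    qed (use arcs in \<open>auto intro!: compact_Un compact_path_image closed_Un closed_path_image arc_imp_path\<close>)
    then obtain T where T: "connected T" "x \<in> T" "y \<in> T"
        "T \<subseteq> - ((path_image g2 \<union> path_image g3) \<union> (path_image g1 \<union> path_image g3))"
      unfolding connected_component_def by auto
    have "T \<inter> frontier V \<noteq> {}"
      using T x y U V by (intro connected_Int_frontier) auto
    then show False using T V(5) by auto
  qed
  have W: "connected (Y \<union> (path_image g3 - {a, b}))"
    using Yarc[of g3 y3] arcs ends y3 by auto
  have Wsub: "Y \<union> (path_image g3 - {a, b}) \<subseteq> inner \<union> outer"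
  proof -
    have "path_image g3 - {a, b} \<subseteq> - ?C" using meet(2,3) by blast
    moreover have "Y \<subseteq> - ?C" using Y(2) by blast
    ultimately show ?thesis unfolding J(8) by blast
  qed
  have "Y \<union> (path_image g3 - {a, b}) \<subseteq> inner \<or> Y \<union> (path_image g3 - {a, b}) \<subseteq> outer"
  proof -
    let ?W = "Y \<union> (path_image g3 - {a, b})"
    have "inner \<inter> outer \<inter> ?W = {}" unfolding J(7) by simp
    then have "inner \<inter> ?W = {} \<or> outer \<inter> ?W = {}"
      using connectedD[OF W J(5,6) _ Wsub] by blast
    moreover have "P \<inter> T = {} \<or> Q \<inter> T = {} \<Longrightarrow> T \<subseteq> P \<union> Q \<Longrightarrow> T \<subseteq> P \<or> T \<subseteq> Q"
      for P Q T :: "complex set" by blast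
    ultimately show ?thesis using Wsub by metis
  qed
  then show False
  proof
    assume "Y \<union> (path_image g3 - {a, b}) \<subseteq> inner"
    then show False using J by (intro main[of outer inner]) (simp_all add: Un_commute Int_commute)
  next
    assume "Y \<union> (path_image g3 - {a, b}) \<subseteq> outer"
    then show False using J by (intro main[of inner outer]) simp_all
  qed
qed

text \<open>Branch points of a tripod may coincide with its feet, so legs are allowed to be single points.\<close>

definition arc_or_point :: "complex set \<Rightarrow> complex \<Rightarrow> complex \<Rightarrow> bool" where
  "arc_or_point L x y \<longleftrightarrow> (x = y \<and> L = {x}) \<or>
     (\<exists>g. arc g \<and> pathstart g = x \<and> pathfinish g = y \<and> path_image g = L)"

lemma arc_or_point_arc: "arc g \<Longrightarrow> arc_or_point (path_image g) (pathstart g) (pathfinish g)"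
  by (auto simp: arc_or_point_def)

lemma arc_or_point_ends: "arc_or_point L x y \<Longrightarrow> x \<in> L \<and> y \<in> L"
  by (auto simp: arc_or_point_def)

lemma arc_or_point_sym: "arc_or_point L x y \<Longrightarrow> arc_or_point L y x"
  unfolding arc_or_point_def
  by (metis arc_reversepath path_image_reversepath pathfinish_reversepath pathstart_reversepath)

lemma arc_or_point_join:
  assumes "arc_or_point L x y" "arc_or_point M y z" "L \<inter> M = {y}"
  shows "arc_or_point (L \<union> M) x z"
  using assms(1)[unfolded arc_or_point_def]
proof (elim disjE exE)
  assume "x = y \<and> L = {x}"
  then show ?thesis using assms arc_or_point_ends[OF assms(2)] by (auto simp: insert_absorb)
next
  fix g assume g: "arc g \<and> pathstart g = x \<and> pathfinish g = y \<and> path_image g = L"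
  show ?thesis using assms(2)[unfolded arc_or_point_def]
  proof (elim disjE exE)
    assume "y = z \<and> M = {y}"
    then show ?thesis
      using assms arc_or_point_ends[OF assms(1)] by (auto simp: insert_absorb)
  next
    fix h assume h: "arc h \<and> pathstart h = y \<and> pathfinish h = z \<and> path_image h = M"
    have "arc (g +++ h)" using g h assms(3) by (intro arc_join) auto
    then show ?thesis using g h unfolding arc_or_point_def
      by (metis path_image_join pathfinish_join pathstart_join)
  qed
qed

lemma arc_or_point_split:
  assumes "arc_or_point L x y" "c \<in> L"
  obtains K M where "arc_or_point K x c" "arc_or_point M c y" "K \<union> M = L" "K \<inter> M = {c}"
proof (cases "c = x \<or> c = y")
  case True
  then consider "c = x" | "c = y" by auto
  then show ?thesis
  proof cases
    case 1 then show ?thesis using that[of "{x}" L] assms by (auto simp: arc_or_point_def)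
  next
    case 2 then show ?thesis using that[of L "{y}"] assms by (auto simp: arc_or_point_def)
  qed
next
  case False
  then obtain g where g: "arc g" "pathstart g = x" "pathfinish g = y" "path_image g = L"
    using assms by (auto simp: arc_or_point_def)
  obtain u where u: "u \<in> {0..1}" "g u = c" using assms(2) g(4) by (auto simp: path_image_def)
  have u': "u \<noteq> 0" "u \<noteq> 1" using False g u by (auto simp: pathstart_def pathfinish_def)
  have a: "arc (subpath 0 u g)" "arc (subpath u 1 g)"
    using g(1) u u' by (auto intro!: arc_subpath_arc)
  have im: "path_image (subpath 0 u g) = g ` {0..u}" "path_image (subpath u 1 g) = g ` {u..1}"
    using u by (auto simp: path_image_subpath)
  have inj: "inj_on g {0..1}" using g(1) by (simp add: arc_def)
  have "g ` {0..u} \<union> g ` {u..1} = L"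
    using g(4) u by (auto simp: path_image_def image_Un[symmetric] ivl_disj_un_two_touch)
  moreover have "g ` {0..u} \<inter> g ` {u..1} = {c}"
  proof -
    have "g ` {0..u} \<inter> g ` {u..1} = g ` ({0..u} \<inter> {u..1})"
      using u by (intro inj_on_image_Int[OF inj, symmetric]) auto
    also have "{0..u} \<inter> {u..1} = {u}" using u by auto
    finally show ?thesis using u by simp
  qed
  moreover have "arc_or_point (g ` {0..u}) x c"
    using arc_or_point_arc[OF a(1)] g u unfolding im by (simp add: pathstart_def pathfinish_def subpath_def)
  moreover have "arc_or_point (g ` {u..1}) c y"
    using arc_or_point_arc[OF a(2)] g u unfolding im by (simp add: pathstart_def pathfinish_def subpath_def)
  ultimately show ?thesis using that by blast
qed

lemma arc_or_point_closed: "arc_or_point L x y \<Longrightarrow> closed L"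
  by (auto simp: arc_or_point_def arc_imp_path closed_path_image)

text \<open>Prepares the legs of the sixth branch set, which must stop short of the theta curve and
  still touch it in the closure.\<close>

lemma arc_or_point_delete_end:
  assumes "arc_or_point L x y" "x \<noteq> y"
  shows "connected (L - {y})" "y \<in> closure (L - {y})" "x \<in> L - {y}"
proof -
  obtain g where g: "arc g" "pathstart g = x" "pathfinish g = y" "path_image g = L"
    using assms by (auto simp: arc_or_point_def)
  have inj: "inj_on g {0..1}" using g(1) by (simp add: arc_def)
  have cont: "continuous_on {0..1} g" using g(1) by (simp add: arc_def path_def)
  have eq: "g ` {0..<1} = L - {y}"
  proof -
    have "{0..<1} = {0..1} - {1::real}" by auto
    then have "g ` {0..<1} = g ` {0..1} - g ` {1}"
      using inj_on_image_set_diff[OF inj, of "{0..1}" "{1}"] by auto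
    then show ?thesis using g by (auto simp: path_image_def pathfinish_def)
  qed
  show "connected (L - {y})"
    unfolding eq[symmetric]
    by (intro connected_continuous_image continuous_on_subset[OF cont]) auto
  have "g ` closure {0..<1} \<subseteq> closure (g ` {0..<1})"
    using cont by (intro image_closure_subset) (auto simp: closure_subset)
  moreover have "y \<in> g ` closure {0..<1}"
    using g(3) by (auto simp: pathfinish_def intro!: image_eqI[of _ _ 1])
  ultimately show "y \<in> closure (L - {y})" unfolding eq by auto
  show "x \<in> L - {y}" using assms g(2,4) by auto
qed

lemma path_connected_arc_or_point:
  assumes "path_connected S" "x \<in> S" "y \<in> S"
  obtains L where "arc_or_point L x y" "L \<subseteq> S"
  using assms unfolding path_connected_arcwise arc_or_point_def
  by (metis empty_subsetI insert_subset)

text \<open>Join \<open>p 0\<close> and \<open>p 1\<close> by an arc \<open>L\<close>, follow a path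
  from \<open>p 2\<close> until it first meets \<open>L\<close>, and cut \<open>L\<close> there. If
  the cut falls on one of the three points, that leg degenerates to a point.\<close>

lemma tripod:
  fixes p :: "nat \<Rightarrow> complex"
  assumes S: "path_connected S" and p: "\<And>k. k < 3 \<Longrightarrow> p k \<in> S"
  obtains c G where "\<And>k. k < 3 \<Longrightarrow> arc_or_point (G k) c (p k)" "\<And>k. k < 3 \<Longrightarrow> G k \<subseteq> S"
    "\<And>k l. k < 3 \<Longrightarrow> l < 3 \<Longrightarrow> k \<noteq> l \<Longrightarrow> G k \<inter> G l = {c}"
proof -
  obtain L where L: "arc_or_point L (p 0) (p 1)" "L \<subseteq> S"
    using path_connected_arc_or_point[OF S, of "p 0" "p 1"] p by auto
  obtain c M where M: "c \<in> L" "arc_or_point M c (p 2)" "M \<subseteq> S" "M \<inter> L = {c}"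
  proof (cases "p 2 \<in> L")
    case True
    then show ?thesis using that[of "p 2" "{p 2}"] p[of 2] by (auto simp: arc_or_point_def)
  next
    case False
    obtain g where g: "path g" "path_image g \<subseteq> S" "pathstart g = p 2" "pathfinish g = p 0"
      using S[unfolded path_connected_def, rule_format, of "p 2" "p 0"] p[of 0] p[of 2] by auto
    have "pathstart g \<in> closure (- L)" using False g closure_subset[of "- L"] by auto
    moreover have "pathfinish g \<notin> - L" using g arc_or_point_ends[OF L(1)] by auto
    ultimately obtain h where h: "path h" "pathstart h = p 2" "path_image h \<subseteq> path_image g"
       "path_image h - {pathfinish h} \<subseteq> interior (- L)" "pathfinish h \<in> frontier (- L)"
      using exists_path_subpath_to_frontier[OF g(1)] g(3) by metis
    have fin: "pathfinish h \<in> L"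
      using h(5) arc_or_point_closed[OF L(1)] by (auto simp: frontier_def closure_complement interior_complement)
    \<comment> \<open>The path up to the first hit may cross itself; an arc inside it still has only
      its end on \<open>L\<close>.\<close>
    obtain K where K: "arc K" "path_image K \<subseteq> path_image h" "pathstart K = pathfinish h" "pathfinish K = p 2"
      using path_contains_arc[of "reversepath h" "pathfinish h" "p 2"] h(1,2) False fin
      by (metis path_image_reversepath path_reversepath pathfinish_reversepath pathstart_reversepath)
    have "path_image K \<inter> L = {pathfinish h}"
      using K h(4) fin interior_subset pathstart_in_path_image[of K] by fastforce
    then show ?thesis
      using that[of "pathfinish h" "path_image K"] K fin arc_or_point_arc[OF K(1)] h(3) g(2) by auto
  qed
  obtain K0 K1 where K: "arc_or_point K0 (p 0) c" "arc_or_point K1 c (p 1)" "K0 \<union> K1 = L" "K0 \<inter> K1 = {c}"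
    using arc_or_point_split[OF L(1) M(1)] by metis
  have c: "c \<in> K0" "c \<in> K1" using K(4) by auto
  define G where "G = (\<lambda>k::nat. if k = 0 then K0 else if k = 1 then K1 else M)"
  have lt3: "k < 3 \<longleftrightarrow> k = 0 \<or> k = 1 \<or> k = 2" for k :: nat by auto
  show ?thesis
  proof (rule that[of G c])
    fix k :: nat assume "k < 3"
    then show "arc_or_point (G k) c (p k)" "G k \<subseteq> S"
      using K M L arc_or_point_sym[OF K(1)] unfolding lt3 by (auto simp: G_def)
  next
    fix k l :: nat assume "k < 3" "l < 3" "k \<noteq> l"
    then show "G k \<inter> G l = {c}"
      using K M c unfolding lt3 by (auto simp: G_def)
  qed
qed


section \<open>K_{3,3} with path-connected plane sets as branch sets\<close>

text \<open>Tripods inside the branch sets extend the nine connecting arcs to a subdivision of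
  K_{3,3} with branch vertices \<open>a i\<close> and \<open>c j\<close>. The paths from
  \<open>a 0\<close> to \<open>a 1\<close> through the three points \<open>c j\<close> form a theta
  curve; \<open>A 2\<close> with its three paths up to, but excluding, the \<open>c j\<close> is a
  connected set touching all of them.\<close>

theorem no_K33_minor_in_plane:
  fixes A B :: "nat \<Rightarrow> complex set" and e :: "nat \<Rightarrow> nat \<Rightarrow> real \<Rightarrow> complex"
  assumes pc: "\<And>i. i < 3 \<Longrightarrow> path_connected (A i)" "\<And>j. j < 3 \<Longrightarrow> path_connected (B j)"
    and AA: "\<And>i j. i < 3 \<Longrightarrow> j < 3 \<Longrightarrow> i \<noteq> j \<Longrightarrow> A i \<inter> A j = {}"
    and BB: "\<And>i j. i < 3 \<Longrightarrow> j < 3 \<Longrightarrow> i \<noteq> j \<Longrightarrow> B i \<inter> B j = {}"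
    and AB: "\<And>i j. i < 3 \<Longrightarrow> j < 3 \<Longrightarrow> A i \<inter> B j = {}"
    and e: "\<And>i j. i < 3 \<Longrightarrow> j < 3 \<Longrightarrow> arc (e i j)"
      "\<And>i j. i < 3 \<Longrightarrow> j < 3 \<Longrightarrow> pathstart (e i j) \<in> A i"
      "\<And>i j. i < 3 \<Longrightarrow> j < 3 \<Longrightarrow> pathfinish (e i j) \<in> B j"
    and eA: "\<And>i j k. i < 3 \<Longrightarrow> j < 3 \<Longrightarrow> k < 3 \<Longrightarrow> path_image (e i j) \<inter> A k \<subseteq> {pathstart (e i j)}"
    and eB: "\<And>i j k. i < 3 \<Longrightarrow> j < 3 \<Longrightarrow> k < 3 \<Longrightarrow> path_image (e i j) \<inter> B k \<subseteq> {pathfinish (e i j)}"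
    and ee: "\<And>i j i' j'. i < 3 \<Longrightarrow> j < 3 \<Longrightarrow> i' < 3 \<Longrightarrow> j' < 3 \<Longrightarrow> (i, j) \<noteq> (i', j') \<Longrightarrow>
      path_image (e i j) \<inter> path_image (e i' j') \<subseteq> (\<Union>k<3. A k \<union> B k)"
  shows False
proof -
  define s where "s = (\<lambda>i j. pathstart (e i j))"
  define f where "f = (\<lambda>i j. pathfinish (e i j))"
  have sA: "s i j \<in> A i" and fB: "f i j \<in> B j" if "i < 3" "j < 3" for i j
    using e that by (auto simp: s_def f_def)
  have "\<exists>c G. (\<forall>k<3. arc_or_point (G k) c (s i k) \<and> G k \<subseteq> A i) \<and>
      (\<forall>k<3. \<forall>l<3. k \<noteq> l \<longrightarrow> G k \<inter> G l = {c})" if "i < 3" for i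
    using tripod[OF pc(1)[OF that], of "s i"] sA[OF that] by metis
  then obtain a GA where GA: "\<And>i k. i < 3 \<Longrightarrow> k < 3 \<Longrightarrow> arc_or_point (GA i k) (a i) (s i k)"
     "\<And>i k. i < 3 \<Longrightarrow> k < 3 \<Longrightarrow> GA i k \<subseteq> A i"
     "\<And>i k l. i < 3 \<Longrightarrow> k < 3 \<Longrightarrow> l < 3 \<Longrightarrow> k \<noteq> l \<Longrightarrow> GA i k \<inter> GA i l = {a i}"
    by metis
  have "\<exists>c G. (\<forall>k<3. arc_or_point (G k) c (f k j) \<and> G k \<subseteq> B j) \<and>
      (\<forall>k<3. \<forall>l<3. k \<noteq> l \<longrightarrow> G k \<inter> G l = {c})" if "j < 3" for j
    using tripod[OF pc(2)[OF that], of "\<lambda>i. f i j"] fB[OF _ that] by metis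
  then obtain c GB where GB: "\<And>j k. j < 3 \<Longrightarrow> k < 3 \<Longrightarrow> arc_or_point (GB j k) (c j) (f k j)"
     "\<And>j k. j < 3 \<Longrightarrow> k < 3 \<Longrightarrow> GB j k \<subseteq> B j"
     "\<And>j k l. j < 3 \<Longrightarrow> k < 3 \<Longrightarrow> l < 3 \<Longrightarrow> k \<noteq> l \<Longrightarrow> GB j k \<inter> GB j l = {c j}"
    by metis
  define E where "E = (\<lambda>i j. path_image (e i j))"
  define H where "H = (\<lambda>i j. GA i j \<union> E i j \<union> GB j i)"
  have sG: "s i j \<in> GA i j" "a i \<in> GA i j" if "i < 3" "j < 3" for i j
    using arc_or_point_ends[OF GA(1)[OF that]] by auto
  have fG: "f i j \<in> GB j i" "c j \<in> GB j i" if "i < 3" "j < 3" for i j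
    using arc_or_point_ends[OF GB(1)[OF that(2,1)]] by auto
  have aA: "a i \<in> A i" if "i < 3" for i
    using GA(2)[OF that, of 0] sG(2)[OF that, of 0] by auto
  have cB: "c j \<in> B j" if "j < 3" for j
    using GB(2)[OF that, of 0] fG(2)[OF _ that, of 0] by auto
  have EA: "k = i \<and> x = s i j" if "x \<in> E i j" "x \<in> A k" "i < 3" "j < 3" "k < 3" for x i j k
    using eA[OF that(3-5)] AA[OF that(3,5)] sA[OF that(3,4)] that by (auto simp: E_def s_def)
  have EB: "k = j \<and> x = f i j" if "x \<in> E i j" "x \<in> B k" "i < 3" "j < 3" "k < 3" for x i j k
    using eB[OF that(3-5)] BB[OF that(4,5)] fB[OF that(3,4)] that by (auto simp: E_def f_def)
  have HA: "k = i \<and> x \<in> GA i j" if "x \<in> H i j" "x \<in> A k" "i < 3" "j < 3" "k < 3" for x i j k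
    using that(1) unfolding H_def
  proof (elim UnE)
    assume "x \<in> GA i j" then show ?thesis using GA(2)[OF that(3,4)] AA[OF that(3,5)] that by auto
  next
    assume "x \<in> E i j" then show ?thesis using EA that sG by blast
  next
    assume "x \<in> GB j i" then show ?thesis using GB(2)[OF that(4,3)] AB[OF that(5,4)] that by auto
  qed
  have HB: "k = j \<and> x \<in> GB j i" if "x \<in> H i j" "x \<in> B k" "i < 3" "j < 3" "k < 3" for x i j k
    using that(1) unfolding H_def
  proof (elim UnE)
    assume "x \<in> GA i j" then show ?thesis using GA(2)[OF that(3,4)] AB[OF that(3,5)] that by auto
  next
    assume "x \<in> E i j" then show ?thesis using EB that fG by blast
  next
    assume "x \<in> GB j i" then show ?thesis using GB(2)[OF that(4,3)] BB[OF that(4,5)] that by auto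
  qed
  have HH: "\<exists>k<3. x \<in> A k \<or> x \<in> B k"
    if "x \<in> H i j" "x \<in> H i' j'" "i < 3" "j < 3" "i' < 3" "j' < 3" "(i, j) \<noteq> (i', j')" for x i j i' j'
  proof (cases "x \<in> E i j \<and> x \<in> E i' j'")
    case True
    then show ?thesis using ee[OF that(3-7)] by (auto simp: E_def)
  next
    case False
    then have "x \<in> GA i j \<or> x \<in> GB j i \<or> x \<in> GA i' j' \<or> x \<in> GB j' i'"
      using that(1,2) by (auto simp: H_def)
    then have "x \<in> A i \<or> x \<in> B j \<or> x \<in> A i' \<or> x \<in> B j'"
      using GA(2)[OF that(3,4)] GB(2)[OF that(4,3)] GA(2)[OF that(5,6)] GB(2)[OF that(6,5)] by auto
    then show ?thesis using that(3-6) by metis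
  qed
  \<comment> \<open>Two different paths meet only inside a branch set, where both run along tripod
    legs; distinct legs of one tripod share just its centre.\<close>
  have HHG: "(i = i' \<and> x \<in> GA i j \<inter> GA i j') \<or> (j = j' \<and> x \<in> GB j i \<inter> GB j i')"
    if "x \<in> H i j" "x \<in> H i' j'" "i < 3" "j < 3" "i' < 3" "j' < 3" "(i, j) \<noteq> (i', j')" for x i j i' j'
  proof -
    from HH[OF that] obtain k where k: "k < 3" "x \<in> A k \<or> x \<in> B k"
      by blast
    from k(2) show ?thesis
    proof
      assume "x \<in> A k"
      then show ?thesis
        using HA[OF that(1) _ that(3,4) k(1)] HA[OF that(2) _ that(5,6) k(1)] by simp
    next
      assume "x \<in> B k"
      then show ?thesis
        using HB[OF that(1) _ that(3,4) k(1)] HB[OF that(2) _ that(5,6) k(1)] by simp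
    qed
  qed
  have Hc: "H i j \<inter> H i' j \<subseteq> {c j}" if "i < 3" "i' < 3" "j < 3" "i \<noteq> i'" for i i' j
    using HHG[OF _ _ that(1,3,2,3)] GB(3)[OF that(3,1,2,4)] that(4) by blast
  have Ha: "H i j \<inter> H i j' \<subseteq> {a i}" if "i < 3" "j < 3" "j' < 3" "j \<noteq> j'" for i j j'
    using HHG[OF _ _ that(1,2,1,3)] GA(3)[OF that] that(4) by blast
  have H0: "H i j \<inter> H i' j' = {}" if "i < 3" "i' < 3" "j < 3" "j' < 3" "i \<noteq> i'" "j \<noteq> j'" for i i' j j'
    using HHG[OF _ _ that(1,3,2,4)] that(5,6) by blast
  have aH: "a i \<in> H i j" "c j \<in> H i j" if "i < 3" "j < 3" for i j
    using sG fG that by (auto simp: H_def)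
  have Earc: "arc_or_point (E i j) (s i j) (f i j)" if "i < 3" "j < 3" for i j
    using arc_or_point_arc[OF e(1)[OF that]] by (simp add: E_def s_def f_def)
  have EGB: "E i j \<inter> GB j i = {f i j}" if "i < 3" "j < 3" for i j
    using EB[OF _ _ that that(2)] GB(2)[OF that(2,1)] fG[OF that] arc_or_point_ends[OF Earc[OF that]] by blast
  have GAE: "GA i j \<inter> E i j = {s i j}" if "i < 3" "j < 3" for i j
    using EA[OF _ _ that that(1)] GA(2)[OF that] sG[OF that] arc_or_point_ends[OF Earc[OF that]] by blast
  have EGBarc: "arc_or_point (E i j \<union> GB j i) (s i j) (c j)" if "i < 3" "j < 3" for i j
    using that by (intro arc_or_point_join[OF Earc _ EGB] arc_or_point_sym[OF GB(1)])
  have Harc: "arc_or_point (H i j) (a i) (c j)" if "i < 3" "j < 3" for i j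
  proof -
    have "GA i j \<inter> (E i j \<union> GB j i) = {s i j}"
      using GAE[OF that] GA(2)[OF that] GB(2)[OF that(2,1)] AB[OF that] by blast
    then show ?thesis using arc_or_point_join[OF GA(1) EGBarc] that unfolding H_def by (auto simp: Un_assoc)
  qed
  have "\<exists>g. arc g \<and> pathstart g = a 0 \<and> pathfinish g = a 1 \<and> path_image g = H 0 j \<union> H 1 j" if "j < 3" for j
  proof -
    have "H 0 j \<inter> H 1 j = {c j}" using Hc[of 0 1 j] aH[of _ j] that by auto
    then have "arc_or_point (H 0 j \<union> H 1 j) (a 0) (a 1)"
      using arc_or_point_join[OF Harc arc_or_point_sym[OF Harc], of 0 j 1] that by auto
    moreover have "a 0 \<noteq> a 1" using aA[of 0] aA[of 1] AA[of 0 1] by auto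
    ultimately show ?thesis by (auto simp: arc_or_point_def)
  qed
  then obtain g where g: "\<And>j. j < 3 \<Longrightarrow> arc (g j)" "\<And>j. j < 3 \<Longrightarrow> pathstart (g j) = a 0"
     "\<And>j. j < 3 \<Longrightarrow> pathfinish (g j) = a 1" "\<And>j. j < 3 \<Longrightarrow> path_image (g j) = H 0 j \<union> H 1 j" by metis
  have gg: "path_image (g j) \<inter> path_image (g j') = {a 0, a 1}" if "j < 3" "j' < 3" "j \<noteq> j'" for j j'
  proof -
    have "H 0 j \<inter> H 0 j' \<subseteq> {a 0}" "H 1 j \<inter> H 1 j' \<subseteq> {a 1}" "H 0 j \<inter> H 1 j' = {}" "H 1 j \<inter> H 0 j' = {}"
      using Ha[OF _ that, of 0] Ha[OF _ that, of 1] H0[OF _ _ that(1,2) _ that(3), of 0 1]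
        H0[OF _ _ that(1,2) _ that(3), of 1 0] by simp_all
    moreover have "a 0 \<in> H 0 j" "a 0 \<in> H 0 j'" "a 1 \<in> H 1 j" "a 1 \<in> H 1 j'"
      using aH(1) that by simp_all
    ultimately show ?thesis unfolding g(4)[OF that(1)] g(4)[OF that(2)] by blast
  qed
  \<comment> \<open>The point \<open>c j\<close> lies on the theta curve and has to be removed; the
    remainder stays connected and keeps \<open>c j\<close> in its closure.\<close>
  define h where "h = (\<lambda>j. E 2 j \<union> GB j 2 - {c j})"
  have sc: "s 2 j \<noteq> c j" if "j < 3" for j
    using sA[of 2 j] cB[of j] AB[of 2 j] that by auto
  have h: "connected (h j)" "c j \<in> closure (h j)" "s 2 j \<in> h j" if "j < 3" for j
    using arc_or_point_delete_end[OF EGBarc[of 2 j] sc[OF that]] that by (auto simp: h_def)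
  have hs: "s 2 j \<in> A 2 \<inter> h j" if "j < 3" for j
    using h(3) sA[of 2] that by auto
  define Y where "Y = A 2 \<union> h 0 \<union> h 1 \<union> h 2"
  have Ycon: "connected Y"
  proof -
    have h': "connected (h 0)" "connected (h 1)" "connected (h 2)" "s 2 0 \<in> A 2 \<inter> h 0"
       "s 2 1 \<in> A 2 \<inter> h 1" "s 2 2 \<in> A 2 \<inter> h 2"
      by (intro h(1) hs; simp)+
    have "connected (A 2)"
      by (intro path_connected_imp_connected[OF pc(1)]) simp
    then have "connected (A 2 \<union> h 0)"
      by (rule connected_Un[OF _ h'(1)]) (use h'(4) in blast)
    then have "connected (A 2 \<union> h 0 \<union> h 1)"
      by (rule connected_Un[OF _ h'(2)]) (use h'(5) in blast)
    then show ?thesis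
      unfolding Y_def by (rule connected_Un[OF _ h'(3)]) (use h'(6) in blast)
  qed
  have Ah: "A 2 \<inter> H i j = {}" if "i < 2" "j < 3" for i j
  proof -
    have i: "i < 3" "i \<noteq> 2" "2 < (3::nat)" using that by auto
    have "x \<notin> H i j" if "x \<in> A 2" for x
      using HA[OF _ that i(1) \<open>j < 3\<close> i(3)] i(2) by metis
    then show ?thesis by blast
  qed
  have hH: "h j \<inter> H i j' = {}" if "i < 2" "j < 3" "j' < 3" for i j j'
  proof (cases "j = j'")
    case True
    have "h j \<subseteq> H 2 j - {c j}" by (auto simp: h_def H_def)
    moreover have "H 2 j \<inter> H i j \<subseteq> {c j}" using that by (intro Hc) auto
    ultimately show ?thesis unfolding True[symmetric] by blast
  next
    case False
    have "h j \<subseteq> H 2 j" by (auto simp: h_def H_def)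
    moreover have "H 2 j \<inter> H i j' = {}" using that False by (intro H0) auto
    ultimately show ?thesis by blast
  qed
  have Yg: "Y \<inter> path_image (g j) = {}" if "j < 3" for j
  proof -
    have "Y \<inter> H i j = {}" if i: "i < 2" for i
    proof -
      have "h 0 \<inter> H i j = {}" "h 1 \<inter> H i j = {}" "h 2 \<inter> H i j = {}"
        using hH[OF i _ \<open>j < 3\<close>] by simp_all
      then show ?thesis using Ah[OF i \<open>j < 3\<close>] unfolding Y_def by blast
    qed
    from this[of 0] this[of 1] show ?thesis unfolding g(4)[OF that] by (simp add: Int_Un_distrib)
  qed
  have cY: "c j \<in> closure Y" if "j < 3" for j
  proof -
    have "j = 0 \<or> j = 1 \<or> j = 2" using that by auto
    then have "h j \<subseteq> Y" by (auto simp: Y_def)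
    then show ?thesis using h(2)[OF that] closure_mono by blast
  qed
  have cg: "c j \<in> path_image (g j) - {a 0, a 1}" if "j < 3" for j
  proof -
    have "c j \<noteq> a 0" "c j \<noteq> a 1"
      using cB[OF that] aA[of 0] aA[of 1] AB[OF _ that, of 0] AB[OF _ that, of 1] by force+
    then show ?thesis using aH(2)[of 0 j] g(4)[OF that] that by simp
  qed
  have lt: "0 < (3::nat)" "1 < (3::nat)" "2 < (3::nat)" by auto
  have Yall: "Y \<inter> (path_image (g 0) \<union> path_image (g 1) \<union> path_image (g 2)) = {}"
    using Yg[OF lt(1)] Yg[OF lt(2)] Yg[OF lt(3)] by blast
  have meet: "path_image (g 0) \<inter> path_image (g 1) = {a 0, a 1}"
    "path_image (g 0) \<inter> path_image (g 2) = {a 0, a 1}" "path_image (g 1) \<inter> path_image (g 2) = {a 0, a 1}"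
    by (rule gg; simp)+
  show False
    by (rule theta_curve_separation[OF g(1) g(1) g(1) g(2) g(3) g(2) g(3) g(2) g(3) meet Ycon Yall
        cY[OF lt(1)] cg[OF lt(1)] cY[OF lt(2)] cg[OF lt(2)] cY[OF lt(3)] cg[OF lt(3)]]) (rule lt)+
qed

section \<open>Sparsity of graphs without clique minors\<close>

definition set_adj :: "'a set set \<Rightarrow> 'a set \<Rightarrow> 'a set \<Rightarrow> bool" where
  "set_adj E A B \<longleftrightarrow> (\<exists>u\<in>A. \<exists>v\<in>B. {u, v} \<in> E)"

lemma set_adj_sym: "set_adj E A B \<longleftrightarrow> set_adj E B A"
  unfolding set_adj_def by (metis insert_commute)

lemma set_adj_mono: "set_adj E A B \<Longrightarrow> A \<subseteq> A' \<Longrightarrow> B \<subseteq> B' \<Longrightarrow> set_adj E A' B'"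
  unfolding set_adj_def by blast

text \<open>Connectedness as contraction produces it: a set grows by merging disjoint adjacent ones.
  Its induction rule is a recipe for building a path-connected plane set, with one edge curve per
  merge.\<close>

inductive conn :: "'a set set \<Rightarrow> 'a set \<Rightarrow> bool" for E where
  conn_single: "conn E {v}"
| conn_join: "conn E A \<Longrightarrow> conn E B \<Longrightarrow> A \<inter> B = {} \<Longrightarrow> set_adj E A B \<Longrightarrow> conn E (A \<union> B)"

lemma conn_nonempty: "conn E A \<Longrightarrow> A \<noteq> {}"
  by (induction rule: conn.induct) auto

definition branch_family :: "'a set set \<Rightarrow> 'a set set \<Rightarrow> bool" where
  "branch_family E P \<longleftrightarrow> finite P \<and> (\<forall>A\<in>P. conn E A) \<and> (\<forall>A\<in>P. \<forall>B\<in>P. A \<noteq> B \<longrightarrow> A \<inter> B = {})"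

text \<open>Twice the number of edges of the contracted graph, hence its degree sum.\<close>

definition num_adj :: "'a set set \<Rightarrow> 'a set set \<Rightarrow> nat" where
  "num_adj E P = card {(A, B). A \<in> P \<and> B \<in> P \<and> A \<noteq> B \<and> set_adj E A B}"

lemma num_adj_eq_sum:
  assumes "finite P"
  shows "num_adj E P = (\<Sum>A\<in>P. card {B \<in> P. A \<noteq> B \<and> set_adj E A B})"
proof -
  have "{(A, B). A \<in> P \<and> B \<in> P \<and> A \<noteq> B \<and> set_adj E A B} = (SIGMA A:P. {B \<in> P. A \<noteq> B \<and> set_adj E A B})"
    by auto
  then show ?thesis unfolding num_adj_def using assms by simp
qed

lemma num_adj_insert:
  assumes "finite R" "A \<notin> R"
  shows "num_adj E (insert A R) = num_adj E R + 2 * card {Y \<in> R. set_adj E A Y}"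
proof -
  let ?D = "{Y \<in> R. set_adj E A Y}"
  let ?N = "\<lambda>R. {(A, B). A \<in> R \<and> B \<in> R \<and> A \<noteq> B \<and> set_adj E A B}"
  have fin: "finite (?N R)" by (rule finite_subset[of _ "R \<times> R"]) (use assms in auto)
  have eq: "?N (insert A R) = ?N R \<union> (Pair A ` ?D \<union> (\<lambda>Y. (Y, A)) ` ?D)"
    using assms by (auto simp: set_adj_sym)
  have "card (Pair A ` ?D \<union> (\<lambda>Y. (Y, A)) ` ?D) = card (Pair A ` ?D) + card ((\<lambda>Y. (Y, A)) ` ?D)"
    using assms by (intro card_Un_disjoint) auto
  also have "\<dots> = 2 * card ?D"
    by (simp add: card_image inj_on_def)
  finally have "card (Pair A ` ?D \<union> (\<lambda>Y. (Y, A)) ` ?D) = 2 * card ?D" .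
  moreover have "card (?N R \<union> (Pair A ` ?D \<union> (\<lambda>Y. (Y, A)) ` ?D))
      = card (?N R) + card (Pair A ` ?D \<union> (\<lambda>Y. (Y, A)) ` ?D)"
    using assms fin by (intro card_Un_disjoint) auto
  ultimately show ?thesis unfolding num_adj_def eq by simp
qed

text \<open>Contracting an edge loses that edge and, for every common neighbour, one of two edges
  that become parallel; ordered pairs double both losses.\<close>

lemma branch_family_merge:
  assumes P: "branch_family E P" and A: "A \<in> P" and X: "X \<in> P" and ne: "A \<noteq> X" and adj: "set_adj E A X"
  defines "P' \<equiv> insert (A \<union> X) (P - {A, X})"
  shows "branch_family E P'" "card P = Suc (card P')"
    "num_adj E P = num_adj E P' + 2 + 2 * card {Y \<in> P - {A, X}. set_adj E A Y \<and> set_adj E X Y}"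
proof -
  let ?R = "P - {A, X}"
  have fin: "finite P" and cA: "conn E A" and cX: "conn E X" and dAX: "A \<inter> X = {}"
    and disj: "\<And>A B. A \<in> P \<Longrightarrow> B \<in> P \<Longrightarrow> A \<noteq> B \<Longrightarrow> A \<inter> B = {}"
    using P A X ne by (auto simp: branch_family_def)
  have c: "conn E (A \<union> X)" by (rule conn_join[OF cA cX dAX adj])
  have dR: "(A \<union> X) \<inter> B = {}" if "B \<in> ?R" for B
    using disj[OF A, of B] disj[OF X, of B] that by auto
  show "branch_family E P'"
    using P c dR unfolding branch_family_def P'_def by (auto simp: Int_commute)
  have notin: "A \<union> X \<notin> ?R"
    using dR[of "A \<union> X"] conn_nonempty[OF cA] by auto
  have P_eq: "P = insert A (insert X ?R)" using A X by auto
  have "card P = Suc (Suc (card ?R))"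
    by (subst P_eq) (use fin ne in \<open>simp add: card_insert_if\<close>)
  then show "card P = Suc (card P')"
    unfolding P'_def using fin notin by simp
  let ?DA = "{Y \<in> ?R. set_adj E A Y}" and ?DX = "{Y \<in> ?R. set_adj E X Y}"
  have "num_adj E P = num_adj E (insert A (insert X ?R))" using P_eq by simp
  also have "\<dots> = num_adj E (insert X ?R) + 2 * card {Y \<in> insert X ?R. set_adj E A Y}"
    by (rule num_adj_insert) (use fin ne in auto)
  also have "{Y \<in> insert X ?R. set_adj E A Y} = insert X ?DA" using adj by auto
  also have "card (insert X ?DA) = Suc (card ?DA)" using fin by simp
  also have "num_adj E (insert X ?R) = num_adj E ?R + 2 * card ?DX"
    by (rule num_adj_insert) (use fin ne in auto)
  finally have 1: "num_adj E P = num_adj E ?R + 2 * card ?DX + 2 * Suc (card ?DA)" .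
  have "num_adj E P' = num_adj E ?R + 2 * card {Y \<in> ?R. set_adj E (A \<union> X) Y}"
    unfolding P'_def by (rule num_adj_insert) (use fin notin in auto)
  also have "{Y \<in> ?R. set_adj E (A \<union> X) Y} = ?DA \<union> ?DX" by (auto simp: set_adj_def)
  finally have 2: "num_adj E P' = num_adj E ?R + 2 * card (?DA \<union> ?DX)" .
  have "card ?DA + card ?DX = card (?DA \<union> ?DX) + card (?DA \<inter> ?DX)"
    using fin by (intro card_Un_Int) auto
  moreover have "?DA \<inter> ?DX = {Y \<in> ?R. set_adj E A Y \<and> set_adj E X Y}" by auto
  ultimately show "num_adj E P = num_adj E P' + 2 + 2 * card {Y \<in> ?R. set_adj E A Y \<and> set_adj E X Y}"
    using 1 2 by simp
qed

text \<open>In a family with the fewest branch sets, contracting an edge must lose many adjacencies, so every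
  edge lies in many triangles and the neighbourhood of any branch set is dense again.\<close>

lemma dense_family_has_clique_minor:
  assumes "branch_family E P" "P \<noteq> {}" "2 ^ r * card P \<le> num_adj E P"
  shows "\<exists>Q. branch_family E Q \<and> card Q = Suc r \<and> (\<forall>A\<in>Q. \<forall>B\<in>Q. A \<noteq> B \<longrightarrow> set_adj E A B) \<and>
    \<Union>Q \<subseteq> \<Union>P \<and> (\<forall>X\<in>Q. \<exists>B\<in>P. B \<subseteq> X)"
  using assms
proof (induction r arbitrary: P)
  case 0
  then obtain A where "A \<in> P" by auto
  then show ?case using 0 by (intro exI[of _ "{A}"]) (auto simp: branch_family_def)
next
  case (Suc r)
  \<comment> \<open>The last two clauses express the minor relation: no new points, and each set
    contains an old one, so that it inherits the adjacencies of the old one.\<close>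
  define good where "good = (\<lambda>P'. branch_family E P' \<and> P' \<noteq> {} \<and> 2 ^ Suc r * card P' \<le> num_adj E P' \<and>
    \<Union>P' \<subseteq> \<Union>P \<and> (\<forall>X\<in>P'. \<exists>B\<in>P. B \<subseteq> X))"
  have "good P" using Suc.prems by (auto simp: good_def)
  then obtain M where M: "good M" "\<And>P'. good P' \<Longrightarrow> card M \<le> card P'"
    using arg_min_nat_lemma[of good P card] by metis
  have bf: "branch_family E M" and Mne: "M \<noteq> {}" and dens: "2 ^ Suc r * card M \<le> num_adj E M"
    and sub: "\<Union>M \<subseteq> \<Union>P" and ref: "\<forall>X\<in>M. \<exists>B\<in>P. B \<subseteq> X"
    using M(1) by (auto simp: good_def)
  have fin: "finite M" and disj: "\<And>A B. A \<in> M \<Longrightarrow> B \<in> M \<Longrightarrow> A \<noteq> B \<Longrightarrow> A \<inter> B = {}"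
    and cn: "\<And>A. A \<in> M \<Longrightarrow> conn E A"
    using bf by (auto simp: branch_family_def)
  have "0 < 2 ^ Suc r * card M" using Mne fin by (simp add: card_gt_0_iff)
  then have "num_adj E M > 0" using dens by linarith
  then have "{(A, B). A \<in> M \<and> B \<in> M \<and> A \<noteq> B \<and> set_adj E A B} \<noteq> {}"
    unfolding num_adj_def by (metis card.empty less_irrefl)
  then obtain A B where AB: "A \<in> M" "B \<in> M" "A \<noteq> B" "set_adj E A B" by auto
  define N where "N = {X \<in> M. A \<noteq> X \<and> set_adj E A X}"
  have deg: "2 ^ r \<le> card {Y \<in> N. X \<noteq> Y \<and> set_adj E X Y}" if "X \<in> N" for X
  proof -
    have X: "X \<in> M" "A \<noteq> X" "set_adj E A X" using that by (auto simp: N_def)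
    let ?M' = "insert (A \<union> X) (M - {A, X})"
    let ?t = "card {Y \<in> M - {A, X}. set_adj E A Y \<and> set_adj E X Y}"
    note mg = branch_family_merge[OF bf AB(1) X(1,2,3)]
    have "\<not> good ?M'" using M(2)[of ?M'] mg(2) by auto
    moreover have "\<Union>?M' \<subseteq> \<Union>P" using sub AB X by blast
    moreover have "\<exists>B\<in>P. B \<subseteq> A \<union> X" using ref AB(1) by (meson le_supI1)
    then have "\<forall>Z\<in>?M'. \<exists>B\<in>P. B \<subseteq> Z" using ref by simp
    ultimately have "num_adj E ?M' < 2 ^ Suc r * card ?M'"
      using mg(1) unfolding good_def by auto
    \<comment> \<open>By minimality the contracted family is too sparse: going down by one set costs
      more than 2^(r+1) ordered adjacencies, and exactly 2 + 2 \<open>?t\<close> are lost.\<close>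
    then have "2 ^ Suc r < 2 + 2 * ?t"
      using mg(2,3) dens by (simp add: algebra_simps)
    then have "2 ^ r \<le> ?t" by simp
    also have "{Y \<in> M - {A, X}. set_adj E A Y \<and> set_adj E X Y} = {Y \<in> N. X \<noteq> Y \<and> set_adj E X Y}"
      by (auto simp: N_def)
    finally show ?thesis .
  qed
  have finN: "finite N" using fin by (simp add: N_def)
  have "branch_family E N" using bf unfolding branch_family_def N_def by simp
  moreover have "N \<noteq> {}" using AB by (auto simp: N_def)
  moreover have "2 ^ r * card N \<le> num_adj E N"
    unfolding num_adj_eq_sum[OF finN] using sum_mono[of N "\<lambda>_. 2 ^ r", OF deg] by (simp add: mult.commute)
  \<comment> \<open>The neighbourhood of \<open>A\<close> has density 2^r and yields r + 1 sets;
    \<open>A\<close> is adjacent to all of them and completes r + 2.\<close>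
  ultimately obtain Q where Q: "branch_family E Q" "card Q = Suc r" "\<forall>A\<in>Q. \<forall>B\<in>Q. A \<noteq> B \<longrightarrow> set_adj E A B"
     "\<Union>Q \<subseteq> \<Union>N" "\<forall>X\<in>Q. \<exists>B\<in>N. B \<subseteq> X"
    using Suc.IH by metis
  have dA: "A \<inter> \<Union>N = {}" using disj[OF AB(1)] by (auto simp: N_def)
  have dQ: "A \<inter> X = {}" if "X \<in> Q" for X using dA Q(4) that by blast
  have notin: "A \<notin> Q" using dQ[of A] conn_nonempty[OF cn[OF AB(1)]] by auto
  have adjQ: "set_adj E A X" if "X \<in> Q" for X
  proof -
    obtain B where "B \<in> N" "B \<subseteq> X" using Q(5) \<open>X \<in> Q\<close> by auto
    then show ?thesis using set_adj_mono[of E A B A X] by (auto simp: N_def)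
  qed
  have "branch_family E (insert A Q)"
    using Q(1) dQ cn[OF AB(1)] unfolding branch_family_def by (auto simp: Int_commute)
  moreover have "card (insert A Q) = Suc (Suc r)"
    using Q(1,2) notin by (simp add: branch_family_def)
  moreover have "\<forall>X\<in>insert A Q. \<forall>Y\<in>insert A Q. X \<noteq> Y \<longrightarrow> set_adj E X Y"
    using Q(3) adjQ by (metis insert_iff set_adj_sym)
  moreover have "\<Union>(insert A Q) \<subseteq> \<Union>P"
  proof -
    have "\<Union>N \<subseteq> \<Union>M" by (auto simp: N_def)
    then have "\<Union>Q \<subseteq> \<Union>P" using Q(4) sub by (meson order_trans)
    moreover have "A \<subseteq> \<Union>P" using sub AB(1) by (meson Union_upper order_trans)
    ultimately show ?thesis by simp
  qed
  moreover have "\<exists>B\<in>P. B \<subseteq> X" if "X \<in> insert A Q" for X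
  proof -
    have "\<exists>B\<in>M. B \<subseteq> X" using that AB(1) Q(5) by (auto simp: N_def)
    then show ?thesis using ref by (meson order_trans)
  qed
  ultimately show ?case by (intro exI[of _ "insert A Q"]) auto
qed

section \<open>Plane graphs\<close>

locale plane_graph =
  fixes n :: nat and E :: "nat set set" and pos :: "nat \<Rightarrow> complex" and curve :: "nat set \<Rightarrow> real \<Rightarrow> complex"
  assumes simple: "simple_graph n E"
    and inj: "inj_on pos {0..<n}"
    and arc: "\<And>e. e \<in> E \<Longrightarrow> arc (curve e)"
    and curve_ends: "\<And>e. e \<in> E \<Longrightarrow> {pathstart (curve e), pathfinish (curve e)} = pos ` e"
    and curve_vertices: "\<And>e. e \<in> E \<Longrightarrow> path_image (curve e) \<inter> pos ` {0..<n} = pos ` e"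
    and curve_meet: "\<And>e e'. e \<in> E \<Longrightarrow> e' \<in> E \<Longrightarrow> e \<noteq> e' \<Longrightarrow>
              path_image (curve e) \<inter> path_image (curve e') \<subseteq> pos ` (e \<inter> e')"
begin

lemma edge_subset: "e \<in> E \<Longrightarrow> e \<subseteq> {0..<n}"
  using simple unfolding simple_graph_def by fastforce

lemma edge_nonempty: "e \<in> E \<Longrightarrow> e \<noteq> {}"
  using simple unfolding simple_graph_def by blast

definition body :: "nat set \<Rightarrow> complex set" where
  "body A = pos ` A \<union> (\<Union>e\<in>{e \<in> E. e \<subseteq> A}. path_image (curve e))"

text \<open>The two bounds on the set have separate uses: containing the vertex points of
  \<open>A\<close> makes all attached edges start in it, and staying inside \<open>body A\<close>
  keeps the sets of disjoint vertex sets apart.\<close>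

lemma conn_path_connected:
  assumes "conn E A"
  shows "\<exists>S. path_connected S \<and> pos ` A \<subseteq> S \<and> S \<subseteq> body A"
  using assms
proof (induction rule: conn.induct)
  case (conn_single v)
  show ?case by (intro exI[of _ "{pos v}"]) (auto simp: body_def)
next
  case (conn_join A B)
  obtain S T where S: "path_connected S" "pos ` A \<subseteq> S" "S \<subseteq> body A"
    and T: "path_connected T" "pos ` B \<subseteq> T" "T \<subseteq> body B"
    using conn_join.IH by blast
  obtain u v where uv: "u \<in> A" "v \<in> B" "{u, v} \<in> E"
    using conn_join.hyps by (auto simp: set_adj_def)
  let ?c = "path_image (curve {u, v})"
  have uc: "pos u \<in> ?c" "pos v \<in> ?c"
    using curve_vertices[OF uv(3)] by auto
  have "path_connected ?c" using arc[OF uv(3)] by (intro path_connected_path_image arc_imp_path)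
  then have "path_connected (S \<union> ?c)"
    using S uc uv by (intro path_connected_Un) auto
  then have "path_connected ((S \<union> ?c) \<union> T)"
    by (rule path_connected_Un[OF _ T(1)]) (use T uc uv in auto)
  moreover have "body A \<subseteq> body (A \<union> B)" "body B \<subseteq> body (A \<union> B)" "?c \<subseteq> body (A \<union> B)"
    using uv by (auto simp: body_def)
  ultimately show ?case
    using S T by (intro exI[of _ "(S \<union> ?c) \<union> T"]) auto
qed

text \<open>A curve passes through no vertex point besides its ends and meets other curves only in
  common ends, so an edge leaving \<open>A\<close> can touch the body of \<open>A\<close> in a
  shared vertex only.\<close>

lemma curve_body:
  assumes "e \<in> E" "\<not> e \<subseteq> A" "A \<subseteq> {0..<n}" "x \<in> path_image (curve e)" "x \<in> body A"
  shows "x \<in> pos ` (e \<inter> A)"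
proof -
  consider "x \<in> pos ` A" | e' where "e' \<in> E" "e' \<subseteq> A" "x \<in> path_image (curve e')"
    using assms(5) by (auto simp: body_def)
  then show ?thesis
  proof cases
    case 1
    then have "x \<in> pos ` e" using curve_vertices[OF assms(1)] assms(3,4) by blast
    then have "x \<in> pos ` e \<inter> pos ` A" using 1 by blast
    then show ?thesis
      using inj_on_image_Int[OF inj edge_subset[OF assms(1)] assms(3)] by simp
  next
    case 2
    then have "x \<in> pos ` (e \<inter> e')" using curve_meet[OF assms(1), of e'] assms(2,4) by blast
    then show ?thesis using 2 by auto
  qed
qed

lemma body_disjoint:
  assumes "A \<inter> B = {}" "A \<subseteq> {0..<n}" "B \<subseteq> {0..<n}"
  shows "body A \<inter> body B = {}"
proof (rule ccontr)
  assume "body A \<inter> body B \<noteq> {}"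
  then obtain x where x: "x \<in> body A" "x \<in> body B" by auto
  have "x \<in> pos ` B"
  proof (rule ccontr)
    assume "x \<notin> pos ` B"
    then obtain e where e: "e \<in> E" "e \<subseteq> B" "x \<in> path_image (curve e)" using x(2) by (auto simp: body_def)
    then have "\<not> e \<subseteq> A" using edge_nonempty[OF e(1)] assms(1) by blast
    from curve_body[OF e(1) this assms(2) e(3) x(1)] show False using e(2) assms(1) by blast
  qed
  moreover have "x \<in> pos ` A"
  proof (rule ccontr)
    assume "x \<notin> pos ` A"
    then obtain e where e: "e \<in> E" "e \<subseteq> A" "x \<in> path_image (curve e)" using x(1) by (auto simp: body_def)
    then have "\<not> e \<subseteq> B" using edge_nonempty[OF e(1)] assms(1) by blast
    from curve_body[OF e(1) this assms(3) e(3) x(2)] show False using e(2) assms(1) by blast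
  qed
  moreover have "pos ` A \<inter> pos ` B = {}"
    using inj_on_image_Int[OF inj assms(2,3)] assms(1) by simp
  ultimately show False by blast
qed

theorem no_K33_minor:
  fixes A B :: "nat \<Rightarrow> nat set"
  assumes c: "\<And>i. i < 3 \<Longrightarrow> conn E (A i)" "\<And>i. i < 3 \<Longrightarrow> conn E (B i)"
    and s: "\<And>i. i < 3 \<Longrightarrow> A i \<subseteq> {0..<n}" "\<And>i. i < 3 \<Longrightarrow> B i \<subseteq> {0..<n}"
    and AA: "\<And>i j. i < 3 \<Longrightarrow> j < 3 \<Longrightarrow> i \<noteq> j \<Longrightarrow> A i \<inter> A j = {}"
    and BB: "\<And>i j. i < 3 \<Longrightarrow> j < 3 \<Longrightarrow> i \<noteq> j \<Longrightarrow> B i \<inter> B j = {}"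
    and AB: "\<And>i j. i < 3 \<Longrightarrow> j < 3 \<Longrightarrow> A i \<inter> B j = {}"
    and adj: "\<And>i j. i < 3 \<Longrightarrow> j < 3 \<Longrightarrow> set_adj E (A i) (B j)"
  shows False
proof -
  obtain S where S: "\<And>i. i < 3 \<Longrightarrow> path_connected (S i)" "\<And>i. i < 3 \<Longrightarrow> pos ` A i \<subseteq> S i"
     "\<And>i. i < 3 \<Longrightarrow> S i \<subseteq> body (A i)"
    using conn_path_connected[OF c(1)] by metis
  obtain T where T: "\<And>i. i < 3 \<Longrightarrow> path_connected (T i)" "\<And>i. i < 3 \<Longrightarrow> pos ` B i \<subseteq> T i"
     "\<And>i. i < 3 \<Longrightarrow> T i \<subseteq> body (B i)"
    using conn_path_connected[OF c(2)] by metis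
  obtain u v where uv: "\<And>i j. i < 3 \<Longrightarrow> j < 3 \<Longrightarrow> u i j \<in> A i" "\<And>i j. i < 3 \<Longrightarrow> j < 3 \<Longrightarrow> v i j \<in> B j"
     "\<And>i j. i < 3 \<Longrightarrow> j < 3 \<Longrightarrow> {u i j, v i j} \<in> E"
    using adj unfolding set_adj_def by metis
  \<comment> \<open>The curve of an edge may run in either direction; \<open>R\<close> fixes the one
    from the \<open>A\<close> side to the \<open>B\<close> side, with the same trace.\<close>
  define R where "R = (\<lambda>i j g. arc g \<and> pathstart g = pos (u i j) \<and> pathfinish g = pos (v i j) \<and>
      path_image g = path_image (curve {u i j, v i j}))"
  have ex: "\<exists>g. R i j g" if "i < 3" "j < 3" for i j
  proof -
    let ?g = "curve {u i j, v i j}"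
    have "{pathstart ?g, pathfinish ?g} = {pos (u i j), pos (v i j)}"
      using curve_ends[OF uv(3)[OF that]] by simp
    then consider "pathstart ?g = pos (u i j)" "pathfinish ?g = pos (v i j)"
      | "pathstart ?g = pos (v i j)" "pathfinish ?g = pos (u i j)"
      by (auto simp: doubleton_eq_iff)
    then show ?thesis
    proof cases
      case 1 then show ?thesis using arc[OF uv(3)[OF that]] unfolding R_def by blast
    next
      case 2 then show ?thesis using arc[OF uv(3)[OF that]]
        by (intro exI[of _ "reversepath ?g"]) (auto simp: arc_reversepath R_def)
    qed
  qed
  define e where "e = (\<lambda>i j. SOME g. R i j g)"
  have "R i j (e i j)" if "i < 3" "j < 3" for i j
    unfolding e_def by (rule someI_ex[OF ex[OF that]])
  then have e: "\<And>i j. i < 3 \<Longrightarrow> j < 3 \<Longrightarrow> arc (e i j)"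
    "\<And>i j. i < 3 \<Longrightarrow> j < 3 \<Longrightarrow> pathstart (e i j) = pos (u i j)"
    "\<And>i j. i < 3 \<Longrightarrow> j < 3 \<Longrightarrow> pathfinish (e i j) = pos (v i j)"
    "\<And>i j. i < 3 \<Longrightarrow> j < 3 \<Longrightarrow> path_image (e i j) = path_image (curve {u i j, v i j})"
    unfolding R_def by simp_all
  have uB: "u i j \<notin> B k" and vA: "v i j \<notin> A k" if "i < 3" "j < 3" "k < 3" for i j k
    using uv(1,2)[OF that(1,2)] AB[OF that(1,3)] AB[OF that(3,2)] by blast+
  show False
  proof (rule no_K33_minor_in_plane[of S T e])
    fix i j k :: nat assume ijk: "i < 3" "j < 3" "k < 3"
    show "path_image (e i j) \<inter> S k \<subseteq> {pathstart (e i j)}"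
    proof
      fix x assume "x \<in> path_image (e i j) \<inter> S k"
      then have "x \<in> path_image (curve {u i j, v i j})" "x \<in> body (A k)"
        using e(4)[OF ijk(1,2)] S(3)[OF ijk(3)] by auto
      then have "x \<in> pos ` ({u i j, v i j} \<inter> A k)"
        using vA[OF ijk] by (intro curve_body[OF uv(3)[OF ijk(1,2)] _ s(1)[OF ijk(3)]]) auto
      then show "x \<in> {pathstart (e i j)}" using vA[OF ijk] e(2)[OF ijk(1,2)] by auto
    qed
    show "path_image (e i j) \<inter> T k \<subseteq> {pathfinish (e i j)}"
    proof
      fix x assume "x \<in> path_image (e i j) \<inter> T k"
      then have "x \<in> path_image (curve {u i j, v i j})" "x \<in> body (B k)"
        using e(4)[OF ijk(1,2)] T(3)[OF ijk(3)] by auto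
      then have "x \<in> pos ` ({u i j, v i j} \<inter> B k)"
        using uB[OF ijk] by (intro curve_body[OF uv(3)[OF ijk(1,2)] _ s(2)[OF ijk(3)]]) auto
      then show "x \<in> {pathfinish (e i j)}" using uB[OF ijk] e(3)[OF ijk(1,2)] by auto
    qed
  next
    fix i j i' j' :: nat assume h: "i < 3" "j < 3" "i' < 3" "j' < 3" "(i, j) \<noteq> (i', j')"
    have "{u i j, v i j} \<noteq> {u i' j', v i' j'}"
    proof
      assume "{u i j, v i j} = {u i' j', v i' j'}"
      then have "u i j = u i' j'" "v i j = v i' j'"
        using uv(1)[OF h(1,2)] uB[OF h(1,2,4)] uv(2)[OF h(3,4)] uv(2)[OF h(1,2)] vA[OF h(1,2,3)] uv(1)[OF h(3,4)]
        by (metis doubleton_eq_iff)+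
      then have "u i j \<in> A i \<inter> A i'" "v i j \<in> B j \<inter> B j'"
        using uv(1)[OF h(1,2)] uv(1)[OF h(3,4)] uv(2)[OF h(1,2)] uv(2)[OF h(3,4)] by auto
      then have "i = i'" "j = j'" using AA[OF h(1,3)] BB[OF h(2,4)] by auto
      then show False using h(5) by simp
    qed
    then have "path_image (e i j) \<inter> path_image (e i' j') \<subseteq> pos ` {u i j, v i j}"
      using curve_meet[OF uv(3)[OF h(1,2)] uv(3)[OF h(3,4)]] e(4)[OF h(1,2)] e(4)[OF h(3,4)] by auto
    also have "\<dots> \<subseteq> S i \<union> T j"
      using S(2)[OF h(1)] T(2)[OF h(2)] uv(1,2)[OF h(1,2)] by auto
    also have "\<dots> \<subseteq> (\<Union>k<3. S k \<union> T k)" using h by blast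
    finally show "path_image (e i j) \<inter> path_image (e i' j') \<subseteq> (\<Union>k<3. S k \<union> T k)" .
  next
    fix i j :: nat assume ij: "i < 3" "j < 3"
    show "S i \<inter> T j = {}"
      using body_disjoint[OF AB[OF ij] s(1)[OF ij(1)] s(2)[OF ij(2)]] S(3)[OF ij(1)] T(3)[OF ij(2)] by blast
    show "arc (e i j)" using e(1)[OF ij] .
    show "pathstart (e i j) \<in> S i" "pathfinish (e i j) \<in> T j"
      using e(2,3)[OF ij] S(2)[OF ij(1)] T(2)[OF ij(2)] uv(1,2)[OF ij] by auto
    assume ne: "i \<noteq> j"
    show "S i \<inter> S j = {}"
      using body_disjoint[OF AA[OF ij ne] s(1)[OF ij(1)] s(1)[OF ij(2)]] S(3)[OF ij(1)] S(3)[OF ij(2)] by blast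
    show "T i \<inter> T j = {}"
      using body_disjoint[OF BB[OF ij ne] s(2)[OF ij(1)] s(2)[OF ij(2)]] T(3)[OF ij(1)] T(3)[OF ij(2)] by blast
  qed (use S(1) T(1) in auto)
qed

lemma not_edge_loop: "{u, u} \<notin> E"
  using simple unfolding simple_graph_def by (metis doubleton_eq_iff)

text \<open>With single vertices as branch sets, density above 32 = 2^5 gives six pairwise adjacent
  branch sets; splitting them three against three is a K_{3,3} minor.\<close>

lemma few_edges:
  assumes W: "W \<subseteq> {0..<n}"
  shows "card {(u, v). u \<in> W \<and> v \<in> W \<and> {u, v} \<in> E} \<le> 32 * card W"
proof (rule ccontr)
  assume "\<not> ?thesis"
  then have gt: "32 * card W < card {(u, v). u \<in> W \<and> v \<in> W \<and> {u, v} \<in> E}" by simp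
  let ?P = "(\<lambda>v. {v}) ` W"
  have finW: "finite W" using W finite_subset by blast
  have bf: "branch_family E ?P" using finW by (auto simp: branch_family_def intro: conn_single)
  have cP: "card ?P = card W" by (simp add: card_image inj_on_def)
  have "num_adj E ?P = card {(u, v). u \<in> W \<and> v \<in> W \<and> {u, v} \<in> E}"
    unfolding num_adj_def
  proof (rule bij_betw_same_card[of "\<lambda>(A, B). (the_elem A, the_elem B)"], rule bij_betw_byWitness[where f' = "\<lambda>(u, v). ({u}, {v})"])
  qed (use not_edge_loop in \<open>auto simp: set_adj_def\<close>)
  then have "2 ^ 5 * card ?P \<le> num_adj E ?P" using gt cP by simp
  moreover have "?P \<noteq> {}" using gt by auto
  ultimately obtain Q where Q: "branch_family E Q" "card Q = 6"
      "\<forall>A\<in>Q. \<forall>B\<in>Q. A \<noteq> B \<longrightarrow> set_adj E A B" "\<Union>Q \<subseteq> \<Union>?P"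
    using dense_family_has_clique_minor[OF bf, of 5] by auto
  have "finite Q" using Q(1) by (simp add: branch_family_def)
  then obtain f where f: "bij_betw f {0..<6::nat} Q"
    using ex_bij_betw_nat_finite[of Q] Q(2) by auto
  have fQ: "f i \<in> Q" if "i < 6" for i using f that by (auto simp: bij_betw_def)
  have fne: "f i \<noteq> f j" if "i < 6" "j < 6" "i \<noteq> j" for i j
    using f that by (auto simp: bij_betw_def inj_on_def)
  have fd: "f i \<inter> f j = {}" if "i < 6" "j < 6" "i \<noteq> j" for i j
    using Q(1) fQ[of i] fQ[of j] fne[OF that] that by (auto simp: branch_family_def)
  have fc: "conn E (f i)" "f i \<subseteq> {0..<n}" if "i < 6" for i
    using Q(1,4) fQ[OF that] W by (auto simp: branch_family_def)
  show False
    by (rule no_K33_minor[of f "\<lambda>i. f (i + 3)"]) (use fc fd Q(3) fQ fne in auto)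
qed

text \<open>A third common neighbour would complete a K_{3,3} whose branch sets are single
  vertices.\<close>

lemma few_common_neighbours:
  assumes "a < n" "b < n" "c < n" "a \<noteq> b" "a \<noteq> c" "b \<noteq> c"
  shows "card {x. {a, x} \<in> E \<and> {b, x} \<in> E \<and> {c, x} \<in> E} \<le> 2"
proof (rule ccontr)
  let ?X = "{x. {a, x} \<in> E \<and> {b, x} \<in> E \<and> {c, x} \<in> E}"
  assume "\<not> ?thesis"
  then have "3 \<le> card ?X" by simp
  then obtain Y where Y: "Y \<subseteq> ?X" "card Y = 3" by (meson obtain_subset_with_card_n)
  then obtain x y z where xyz: "Y = {x, y, z}" "x \<noteq> y" "x \<noteq> z" "y \<noteq> z" by (auto simp: card_Suc_eq numeral_3_eq_3)
  define A where "A = (\<lambda>i::nat. {if i = 0 then a else if i = 1 then b else c})"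
  define B where "B = (\<lambda>i::nat. {if i = 0 then x else if i = 1 then y else z})"
  have lt3: "k < 3 \<longleftrightarrow> k = 0 \<or> k = 1 \<or> k = 2" for k :: nat by auto
  have E: "{a, x} \<in> E" "{b, x} \<in> E" "{c, x} \<in> E" "{a, y} \<in> E" "{b, y} \<in> E" "{c, y} \<in> E"
     "{a, z} \<in> E" "{b, z} \<in> E" "{c, z} \<in> E" using Y xyz by auto
  have lt: "x < n" "y < n" "z < n" using edge_subset[OF E(1)] edge_subset[OF E(4)] edge_subset[OF E(7)] by auto
  have ne: "a \<noteq> x" "b \<noteq> x" "c \<noteq> x" "a \<noteq> y" "b \<noteq> y" "c \<noteq> y" "a \<noteq> z" "b \<noteq> z" "c \<noteq> z"
    using E not_edge_loop by metis+
  show False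
  proof (rule no_K33_minor[of A B])
    fix i j :: nat assume ij: "i < 3" "j < 3"
    show "set_adj E (A i) (B j)" using E ij by (simp add: A_def B_def set_adj_def)
    show "A i \<inter> B j = {}" using ne ij by (simp add: A_def B_def)
    assume "i \<noteq> j"
    then show "A i \<inter> A j = {}" "B i \<inter> B j = {}"
      using ij assms xyz unfolding lt3 by (auto simp: A_def B_def)
  qed (use assms lt in \<open>auto simp: A_def B_def intro: conn_single\<close>)
qed

end

lemma planar_imp_plane_graph:
  assumes "simple_graph n E" "planar n E"
  obtains pos curve where "plane_graph n E pos curve"
proof -
  obtain p :: "nat \<Rightarrow> real \<times> real" and c :: "nat set \<Rightarrow> real \<Rightarrow> real \<times> real" where
    inj: "inj_on p {0..<n}" and
    c: "\<forall>e\<in>E. arc (c e) \<and> {pathstart (c e), pathfinish (c e)} = p ` e \<and>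
              path_image (c e) \<inter> p ` {0..<n} = p ` e" and
    cc: "\<forall>e\<in>E. \<forall>e'\<in>E. e \<noteq> e' \<longrightarrow> path_image (c e) \<inter> path_image (c e') \<subseteq> p ` (e \<inter> e')"
    using assms(2) unfolding planar_def by blast
  define h where "h = (\<lambda>z. Complex (fst z) (snd z))"
  have injh: "inj h" by (auto simp: h_def inj_def prod_eq_iff)
  have lin: "linear h" by (rule linearI) (auto simp: h_def complex_eq_iff)
  have "plane_graph n E (h \<circ> p) (\<lambda>e. h \<circ> c e)"
  proof
    show "simple_graph n E" by fact
    show "inj_on (h \<circ> p) {0..<n}" using inj injh by (auto intro: comp_inj_on inj_on_subset)
  next
    fix e assume e: "e \<in> E"
    show "arc (h \<circ> c e)" using c e by (simp add: arc_linear_image_eq[OF lin injh])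
    have "{pathstart (h \<circ> c e), pathfinish (h \<circ> c e)} = h ` {pathstart (c e), pathfinish (c e)}"
      by (simp add: pathstart_compose pathfinish_compose)
    then show "{pathstart (h \<circ> c e), pathfinish (h \<circ> c e)} = (h \<circ> p) ` e"
      using c e by (simp add: image_comp)
    have "path_image (h \<circ> c e) \<inter> (h \<circ> p) ` {0..<n} = h ` (path_image (c e) \<inter> p ` {0..<n})"
      by (simp add: path_image_compose image_Int[OF injh] image_comp)
    then show "path_image (h \<circ> c e) \<inter> (h \<circ> p) ` {0..<n} = (h \<circ> p) ` e"
      using c e by (simp add: image_comp)
  next
    fix e e' assume e: "e \<in> E" "e' \<in> E" "e \<noteq> e'"
    have "path_image (h \<circ> c e) \<inter> path_image (h \<circ> c e') = h ` (path_image (c e) \<inter> path_image (c e'))"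
      by (simp add: path_image_compose image_Int[OF injh])
    also have "\<dots> \<subseteq> h ` (p ` (e \<inter> e'))" using cc e by (intro image_mono) auto
    finally show "path_image (h \<circ> c e) \<inter> path_image (h \<circ> c e') \<subseteq> (h \<circ> p) ` (e \<inter> e')"
      by (simp add: image_comp)
  qed
  then show ?thesis by (rule that)
qed

section \<open>Counting in sparse graphs without $K_{3,3}$\<close>

text \<open>All the planarity that enters the counting. The edge bound holds for every vertex
  subset, which the layer-cake argument needs; as it counts ordered pairs, 32 bounds the average
  degree.\<close>

locale sparse_graph =
  fixes V :: "'a set" and adj :: "'a \<Rightarrow> 'a \<Rightarrow> bool"
  assumes finV: "finite V"
    and adjV: "adj u v \<Longrightarrow> u \<in> V"
    and adj_sym: "adj u v \<Longrightarrow> adj v u"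
    and irrefl: "\<not> adj u u"
    and sparse: "W \<subseteq> V \<Longrightarrow> card {(u, v). u \<in> W \<and> v \<in> W \<and> adj u v} \<le> 32 * card W"
    and K33_free: "a \<in> V \<Longrightarrow> b \<in> V \<Longrightarrow> c \<in> V \<Longrightarrow> a \<noteq> b \<Longrightarrow> a \<noteq> c \<Longrightarrow> b \<noteq> c \<Longrightarrow>
      card {x. adj a x \<and> adj b x \<and> adj c x} \<le> 2"
begin

section \<open>Degrees, codegrees and their layer-cake estimates\<close>

definition nb :: "'a \<Rightarrow> 'a set" where "nb u = {v. adj u v}"

definition ind :: "'a \<Rightarrow> 'a \<Rightarrow> real" where "ind u v = of_bool (adj u v)"

definition deg :: "'a \<Rightarrow> real" where "deg u = real (card (nb u))"

definition cod :: "'a \<Rightarrow> 'a \<Rightarrow> real" where "cod u v = real (card (nb u \<inter> nb v))"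

text \<open>Bounds the number of paths with second vertex \<open>u\<close> and fourth vertex
  \<open>v\<close>: first, last and middle vertex are chosen independently, coincidences
  included.\<close>

definition weight :: "'a \<Rightarrow> 'a \<Rightarrow> real" where "weight u v = deg u * deg v * cod u v"

abbreviation "n \<equiv> real (card V)"

lemma nb_subset: "nb u \<subseteq> V"
  using adjV adj_sym by (auto simp: nb_def)

lemma fin_nb: "finite (nb u)"
  using nb_subset finV finite_subset by blast

lemma ind_nonneg: "0 \<le> ind u v" and ind_le_1: "ind u v \<le> 1" and ind_sym: "ind u v = ind v u"
  using adj_sym by (auto simp: ind_def)

lemma card_nb_Int: "finite W \<Longrightarrow> real (card (nb u \<inter> W)) = (\<Sum>v\<in>W. ind u v)"
  by (simp add: ind_def nb_def sum.If_cases Int_def conj_commute flip: of_bool_def)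

lemma deg_eq: "deg u = (\<Sum>v\<in>V. ind u v)"
  using card_nb_Int[OF finV, of u] nb_subset[of u] by (simp add: deg_def Int_absorb2)

lemma cod_eq: "cod u v = (\<Sum>x\<in>V. ind x u * ind x v)"
proof -
  have "cod u v = (\<Sum>x\<in>nb v. ind u x)"
    using card_nb_Int[OF fin_nb, of u v] by (simp add: cod_def)
  also have "\<dots> = (\<Sum>x\<in>V. ind x u * ind x v)"
    using finV nb_subset by (intro sum.mono_neutral_cong_left) (auto simp: ind_def nb_def adj_sym dest: adj_sym)
  finally show ?thesis .
qed

lemma cod_sym: "cod u v = cod v u"
  by (simp add: cod_def Int_commute)

lemma weight_sym: "weight u v = weight v u"
  by (simp add: weight_def cod_sym mult.commute mult.left_commute)

lemma deg_nonneg: "0 \<le> deg u" and cod_nonneg: "0 \<le> cod u v"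
  by (auto simp: deg_def cod_def)

lemma weight_nonneg: "0 \<le> weight u v"
  by (simp add: weight_def deg_nonneg cod_nonneg)

lemma deg_le: "deg u \<le> n"
  using card_mono[OF finV nb_subset] by (simp add: deg_def)

lemma cod_le_deg: "cod u v \<le> deg u"
  using card_mono[OF fin_nb, of "nb u \<inter> nb v" u] by (simp add: deg_def cod_def)

lemma sum_ind_le: "W \<subseteq> V \<Longrightarrow> (\<Sum>u\<in>W. \<Sum>v\<in>W. ind u v) \<le> 32 * real (card W)"
proof -
  assume W: "W \<subseteq> V"
  then have fin: "finite W" using finV finite_subset by blast
  have "{(u, v). u \<in> W \<and> v \<in> W \<and> adj u v} = (SIGMA u:W. nb u \<inter> W)"
    by (auto simp: nb_def)
  then have "real (card {(u, v). u \<in> W \<and> v \<in> W \<and> adj u v}) = (\<Sum>u\<in>W. real (card (nb u \<inter> W)))"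
    using fin by simp
  also have "\<dots> = (\<Sum>u\<in>W. \<Sum>v\<in>W. ind u v)" using card_nb_Int[OF fin] by simp
  finally show ?thesis using sparse[OF W] by linarith
qed

lemma sum_deg_le: "(\<Sum>u\<in>V. deg u) \<le> 32 * n"
  using sum_ind_le[of V] by (simp add: deg_eq)

text \<open>Layer-cake summation: the subgraph on the vertices of degree at least k is sparse for every k.\<close>

lemma sum_min_deg_le: "(\<Sum>u\<in>V. \<Sum>v\<in>V. ind u v * min (deg u) (deg v)) \<le> 1024 * n"
proof -
  let ?W = "\<lambda>k. {u \<in> V. k \<le> card (nb u)}"
  let ?K = "{1..card V}"
  have layer: "real m = (\<Sum>k\<in>?K. of_bool (k \<le> m))" if "m \<le> card V" for m
  proof -
    have "?K \<inter> {k. k \<le> m} = {1..m}" using that by auto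
    then show ?thesis by (simp add: of_bool_def sum.If_cases)
  qed
  have cn: "card (nb u) \<le> card V" for u using card_mono[OF finV nb_subset] .
  have "(\<Sum>u\<in>V. \<Sum>v\<in>V. ind u v * min (deg u) (deg v)) =
      (\<Sum>u\<in>V. \<Sum>v\<in>V. \<Sum>k\<in>?K. ind u v * (of_bool (k \<le> card (nb u)) * of_bool (k \<le> card (nb v))))"
  proof (intro sum.cong refl)
    fix u v
    \<comment> \<open>The minimum counts the levels k that both degrees reach.\<close>
    have "min (deg u) (deg v) = real (min (card (nb u)) (card (nb v)))" by (simp add: deg_def)
    also have "\<dots> = (\<Sum>k\<in>?K. of_bool (k \<le> min (card (nb u)) (card (nb v))))"
      by (rule layer) (use cn[of u] in auto)
    also have "\<dots> = (\<Sum>k\<in>?K. of_bool (k \<le> card (nb u)) * of_bool (k \<le> card (nb v)))"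
      by (intro sum.cong) auto
    finally show "ind u v * min (deg u) (deg v) =
      (\<Sum>k\<in>?K. ind u v * (of_bool (k \<le> card (nb u)) * of_bool (k \<le> card (nb v))))"
      by (simp only: sum_distrib_left)
  qed
  also have "\<dots> = (\<Sum>k\<in>?K. \<Sum>u\<in>V. \<Sum>v\<in>V. ind u v * (of_bool (k \<le> card (nb u)) * of_bool (k \<le> card (nb v))))"
    by (rule trans[OF sum.cong[OF refl sum.swap] sum.swap])
  also have "\<dots> = (\<Sum>k\<in>?K. \<Sum>u\<in>?W k. \<Sum>v\<in>?W k. ind u v)"
  proof (rule sum.cong[OF refl])
    fix k
    have "(\<Sum>u\<in>?W k. \<Sum>v\<in>?W k. ind u v) = (\<Sum>u\<in>?W k. \<Sum>v\<in>V. ind u v * of_bool (k \<le> card (nb v)))"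
      using finV by (intro sum.cong refl sum.mono_neutral_cong_left) auto
    also have "\<dots> = (\<Sum>u\<in>V. \<Sum>v\<in>V. ind u v * (of_bool (k \<le> card (nb u)) * of_bool (k \<le> card (nb v))))"
      using finV by (intro sum.mono_neutral_cong_left) auto
    finally show "(\<Sum>u\<in>V. \<Sum>v\<in>V. ind u v * (of_bool (k \<le> card (nb u)) * of_bool (k \<le> card (nb v))))
      = (\<Sum>u\<in>?W k. \<Sum>v\<in>?W k. ind u v)" by simp
  qed
  \<comment> \<open>Sparsity gives a factor 32 on each layer; the layers add up to the degree sum,
    which gives another, so 1024 = 32 * 32.\<close>
  also have "\<dots> \<le> (\<Sum>k\<in>?K. 32 * real (card (?W k)))"
    by (intro sum_mono sum_ind_le) auto
  also have "\<dots> = (\<Sum>k\<in>?K. 32 * (\<Sum>u\<in>V. of_bool (k \<le> card (nb u))))"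
    using finV by (simp add: of_bool_def sum.If_cases Int_def)
  also have "\<dots> = 32 * (\<Sum>u\<in>V. deg u)"
    unfolding sum_distrib_left[symmetric]
    by (subst sum.swap) (simp add: deg_def layer[OF cn])
  also have "\<dots> \<le> 1024 * n" using sum_deg_le by simp
  finally show ?thesis .
qed

lemma sum_deg_deg_le: "(\<Sum>u\<in>V. \<Sum>v\<in>V. ind u v * (deg u * deg v)) \<le> 1024 * n ^ 2"
proof -
  have "deg u * deg v \<le> n * min (deg u) (deg v)" for u v
  proof -
    have "deg u * deg v = max (deg u) (deg v) * min (deg u) (deg v)"
      by (auto simp: max_def min_def)
    also have "\<dots> \<le> n * min (deg u) (deg v)"
      using deg_le deg_nonneg by (intro mult_right_mono) auto
    finally show ?thesis .
  qed
  then have "(\<Sum>u\<in>V. \<Sum>v\<in>V. ind u v * (deg u * deg v)) \<le> (\<Sum>u\<in>V. \<Sum>v\<in>V. ind u v * (n * min (deg u) (deg v)))"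
    by (intro sum_mono mult_left_mono ind_nonneg)
  also have "\<dots> = n * (\<Sum>u\<in>V. \<Sum>v\<in>V. ind u v * min (deg u) (deg v))"
    by (simp add: sum_distrib_left mult.left_commute)
  also have "\<dots> \<le> n * (1024 * n)" using sum_min_deg_le by (intro mult_left_mono) auto
  finally show ?thesis by (simp add: power2_eq_square)
qed

text \<open>Walks \<open>u\<close>, \<open>x\<close>, \<open>v\<close> counted by their middle
  vertex: the codegrees of \<open>u\<close> add up to the degrees of its neighbours. This is what
  makes pairs with a low-degree member cheap.\<close>

lemma sum_deg_cod_le: "(\<Sum>u\<in>V. \<Sum>v\<in>V. deg u * cod u v) \<le> 1024 * n ^ 2"
proof -
  have "(\<Sum>v\<in>V. deg u * cod u v) = (\<Sum>x\<in>V. ind u x * (deg u * deg x))" for u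
  proof -
    have "(\<Sum>v\<in>V. deg u * cod u v) = (\<Sum>v\<in>V. \<Sum>x\<in>V. deg u * (ind x u * ind x v))"
      by (simp add: cod_eq sum_distrib_left)
    also have "\<dots> = (\<Sum>x\<in>V. \<Sum>v\<in>V. deg u * (ind x u * ind x v))" by (rule sum.swap)
    also have "\<dots> = (\<Sum>x\<in>V. ind u x * (deg u * deg x))"
    proof (rule sum.cong[OF refl])
      fix x
      show "(\<Sum>v\<in>V. deg u * (ind x u * ind x v)) = ind u x * (deg u * deg x)"
        unfolding deg_eq[of x] ind_sym[of u x] by (simp add: sum_distrib_left mult_ac)
    qed
    finally show ?thesis .
  qed
  then show ?thesis using sum_deg_deg_le by simp
qed

section \<open>The weight sum without and with a dominating pair\<close>

text \<open>All but boundedly many vertices are common neighbours of at most one unordered pair of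
  hubs, so the hub pairs weigh at most (1 - \<delta>) 2 n^3 + O(n^2). That leaves room for 2
  \<delta> n^3 from the other pairs.\<close>

lemma weight_sum_no_dominating_pair:
  assumes n: "V \<noteq> {}" and \<delta>: "0 < \<delta>" "\<delta> \<le> 1"
    and no: "\<And>u v. u \<in> V \<Longrightarrow> v \<in> V \<Longrightarrow> u \<noteq> v \<Longrightarrow> deg u * deg v \<le> (1 - \<delta>) * n ^ 2"
  shows "(\<Sum>u\<in>V. \<Sum>v\<in>V-{u}. weight u v) \<le> 2 * n ^ 3 + 2 * (32768 / \<delta>) ^ 5 * n ^ 2"
proof -
  have n1: "n \<ge> 1" using n finV by (simp add: Suc_le_eq card_gt_0_iff)
  \<comment> \<open>Pairs with a low degree cost 2 * 1024 * \<eta> * n^3, which this choice turns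
    into 2 \<delta> n^3. The number of hubs is then at most 32 / \<eta> = 32768 / \<delta>.\<close>
  define \<eta> where "\<eta> = \<delta> / 1024"
  have \<eta>: "\<eta> > 0" using \<delta> by (simp add: \<eta>_def)
  define H where "H = {u \<in> V. \<eta> * n \<le> deg u}"
  have HV: "H \<subseteq> V" and finH: "finite H" using finV by (auto simp: H_def)
  have "real (card H) * (\<eta> * n) \<le> (\<Sum>u\<in>H. deg u)"
    by (rule sum_bounded_below) (simp add: H_def)
  also have "\<dots> \<le> (\<Sum>u\<in>V. deg u)" using HV finV deg_nonneg by (intro sum_mono2) auto
  also have "\<dots> \<le> 32 * n" by (rule sum_deg_le)
  finally have "real (card H) * \<eta> \<le> 32" using n1 by simp
  then have cH: "real (card H) \<le> 32768 / \<delta>" using \<delta> by (simp add: \<eta>_def field_simps)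
  have K: "2 * real (card H) ^ 5 \<le> 2 * (32768 / \<delta>) ^ 5" using cH by (simp add: power_mono)
  define Z where "Z = (\<lambda>x. {(u, v). u \<in> H \<and> v \<in> H \<and> u \<noteq> v \<and> adj x u \<and> adj x v})"
  have Zsub: "Z x \<subseteq> H \<times> H" for x by (auto simp: Z_def)
  have finZ: "finite (Z x)" for x using Zsub finH by (meson finite_SigmaI finite_subset)
  define B where "B = {x \<in> V. 3 \<le> card (nb x \<inter> H)}"
  have finB: "finite B" using finV by (simp add: B_def)
  have cZ2: "card (Z x) \<le> 2" if "card (nb x \<inter> H) \<le> 2" for x
  proof -
    let ?h = "nb x \<inter> H"
    have fin: "finite ?h" using finH by simp
    have "Z x = (SIGMA u:?h. ?h - {u})" by (auto simp: Z_def nb_def)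
    then have "card (Z x) = (\<Sum>u\<in>?h. card (?h - {u}))" using fin by simp
    also have "\<dots> = card ?h * (card ?h - 1)" using fin by simp
    also have "\<dots> \<le> 2 * 1" using that by (intro mult_le_mono) auto
    finally show ?thesis by simp
  qed
  have cZ: "real (card (Z x)) \<le> 2 + of_bool (x \<in> B) * real (card H) ^ 2" if "x \<in> V" for x
  proof (cases "x \<in> B")
    case True
    have "card (Z x) \<le> card (H \<times> H)" using Zsub finH by (intro card_mono) auto
    then have "real (card (Z x)) \<le> real (card H) ^ 2" by (simp add: power2_eq_square card_cartesian_product flip: of_nat_mult)
    also have "\<dots> \<le> 2 + of_bool (x \<in> B) * real (card H) ^ 2" using True by simp
    finally show ?thesis .
  next
    case False
    then show ?thesis using cZ2[of x] that by (simp add: B_def)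
  qed
  have "B \<subseteq> (\<Union>(p, q, r)\<in>{(p, q, r). p \<in> H \<and> q \<in> H \<and> r \<in> H \<and> p \<noteq> q \<and> p \<noteq> r \<and> q \<noteq> r}.
      {x. adj p x \<and> adj q x \<and> adj r x})" (is "_ \<subseteq> (\<Union>z\<in>?I. ?X z)")
  proof
    fix x assume "x \<in> B"
    then have "3 \<le> card (nb x \<inter> H)" by (simp add: B_def)
    then obtain Y where Y: "Y \<subseteq> nb x \<inter> H" "card Y = 3" by (meson obtain_subset_with_card_n)
    then obtain p q r where "Y = {p, q, r}" "p \<noteq> q" "p \<noteq> r" "q \<noteq> r"
      by (auto simp: card_Suc_eq numeral_3_eq_3)
    then show "x \<in> (\<Union>z\<in>?I. ?X z)" using Y adj_sym
      by (intro UN_I[of "(p, q, r)"]) (auto simp: nb_def)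
  qed
  moreover have Isub: "?I \<subseteq> H \<times> H \<times> H" by auto
  then have finI: "finite ?I" using finH by (meson finite_SigmaI finite_subset)
  moreover have "finite (\<Union>z\<in>?I. ?X z)"
    by (rule finite_subset[OF _ finV]) (use adjV adj_sym in auto)
  ultimately have "card B \<le> card (\<Union>z\<in>?I. ?X z)" by (intro card_mono)
  also have "\<dots> \<le> (\<Sum>z\<in>?I. card (?X z))" using finI by (rule card_UN_le)
  also have "\<dots> \<le> (\<Sum>z\<in>?I. 2)" using K33_free HV by (intro sum_mono) auto
  also have "\<dots> = 2 * card ?I" by simp
  also have "\<dots> \<le> 2 * card (H \<times> H \<times> H)" using Isub finH by (intro mult_le_mono card_mono) auto
  also have "\<dots> = 2 * card H ^ 3" by (simp add: power3_eq_cube card_cartesian_product)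
  finally have cB: "real (card B) \<le> 2 * real (card H) ^ 3"
    by (metis of_nat_le_iff of_nat_mult of_nat_numeral of_nat_power)
  have "(\<Sum>u\<in>H. \<Sum>v\<in>H-{u}. cod u v) = (\<Sum>u\<in>H. \<Sum>v\<in>H-{u}. \<Sum>x\<in>V. ind x u * ind x v)"
    by (simp add: cod_eq)
  also have "\<dots> = (\<Sum>u\<in>H. \<Sum>x\<in>V. \<Sum>v\<in>H-{u}. ind x u * ind x v)"
    by (rule sum.cong[OF refl], rule sum.swap)
  also have "\<dots> = (\<Sum>x\<in>V. \<Sum>u\<in>H. \<Sum>v\<in>H-{u}. ind x u * ind x v)" by (rule sum.swap)
  also have "\<dots> = (\<Sum>x\<in>V. real (card (Z x)))"
  proof (rule sum.cong[OF refl])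
    fix x
    have "(\<Sum>u\<in>H. \<Sum>v\<in>H-{u}. ind x u * ind x v) = (\<Sum>(u, v)\<in>(SIGMA u:H. H - {u}). ind x u * ind x v)"
      using finH by (subst sum.Sigma) auto
    also have "\<dots> = (\<Sum>(u, v)\<in>Z x. 1)"
      using finH by (intro sum.mono_neutral_cong_right) (auto simp: Z_def ind_def)
    finally show "(\<Sum>u\<in>H. \<Sum>v\<in>H-{u}. ind x u * ind x v) = real (card (Z x))"
      by (simp add: case_prod_beta')
  qed
  also have "\<dots> \<le> (\<Sum>x\<in>V. 2 + of_bool (x \<in> B) * real (card H) ^ 2)"
    by (intro sum_mono cZ)
  also have "\<dots> = 2 * n + real (card B) * real (card H) ^ 2"
  proof -
    have "V \<inter> B = B" by (auto simp: B_def)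
    then show ?thesis using finV by (simp add: sum.distrib of_bool_def sum.If_cases flip: sum_distrib_right)
  qed
  also have "\<dots> \<le> 2 * n + 2 * real (card H) ^ 3 * real (card H) ^ 2"
    using cB by (intro add_left_mono mult_right_mono) auto
  also have "\<dots> = 2 * n + 2 * real (card H) ^ 5" by (simp add: mult.assoc flip: power_add)
  finally have hubs: "(\<Sum>u\<in>H. \<Sum>v\<in>H-{u}. cod u v) \<le> 2 * n + 2 * (32768 / \<delta>) ^ 5" using K by linarith
  \<comment> \<open>Unless both vertices are hubs, one degree is below \<eta> n, and the product of
    the degrees is at most \<eta> n times their sum.\<close>
  have pt: "weight u v \<le> \<eta> * n * (deg u * cod u v + deg v * cod v u) + of_bool (u \<in> H \<and> v \<in> H) * ((1 - \<delta>) * n ^ 2 * cod u v)"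
    if "u \<in> V" "v \<in> V" "u \<noteq> v" for u v
  proof (cases "u \<in> H \<and> v \<in> H")
    case True
    have "weight u v \<le> (1 - \<delta>) * n ^ 2 * cod u v"
      unfolding weight_def using no[OF that] cod_nonneg by (intro mult_right_mono)
    moreover have "0 \<le> \<eta> * n * (deg u * cod u v + deg v * cod v u)"
      using \<eta> deg_nonneg cod_nonneg by simp
    ultimately show ?thesis using True by simp
  next
    case False
    then have "deg u \<le> \<eta> * n \<or> deg v \<le> \<eta> * n" using that by (auto simp: H_def)
    moreover have "0 \<le> \<eta> * n" using \<eta> by simp
    ultimately have "deg u * deg v \<le> \<eta> * n * (deg u + deg v)"
      using deg_nonneg[of u] deg_nonneg[of v] mult_right_mono[of "deg u" "\<eta> * n" "deg v"]
        mult_right_mono[of "deg v" "\<eta> * n" "deg u"]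
      by (auto simp: distrib_left mult.commute intro: add_increasing add_increasing2)
    then have "weight u v \<le> \<eta> * n * (deg u + deg v) * cod u v"
      unfolding weight_def using cod_nonneg by (intro mult_right_mono)
    also have "\<dots> = \<eta> * n * (deg u * cod u v + deg v * cod v u)"
      by (simp add: cod_sym[of v u] algebra_simps)
    also have "\<dots> = \<eta> * n * (deg u * cod u v + deg v * cod v u) + of_bool (u \<in> H \<and> v \<in> H) * ((1 - \<delta>) * n ^ 2 * cod u v)"
      using False by (simp only: of_bool_def if_False mult_zero_left add_0_right)
    finally show ?thesis .
  qed
  have "(\<Sum>u\<in>V. \<Sum>v\<in>V-{u}. weight u v) \<le>
      (\<Sum>u\<in>V. \<Sum>v\<in>V-{u}. \<eta> * n * (deg u * cod u v + deg v * cod v u) + of_bool (u \<in> H \<and> v \<in> H) * ((1 - \<delta>) * n ^ 2 * cod u v))"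
    by (intro sum_mono pt) auto
  also have "\<dots> = (\<Sum>u\<in>V. \<Sum>v\<in>V-{u}. \<eta> * n * (deg u * cod u v + deg v * cod v u)) +
      (\<Sum>u\<in>V. \<Sum>v\<in>V-{u}. of_bool (u \<in> H \<and> v \<in> H) * ((1 - \<delta>) * n ^ 2 * cod u v))"
    by (simp only: sum.distrib)
  also have "(\<Sum>u\<in>V. \<Sum>v\<in>V-{u}. of_bool (u \<in> H \<and> v \<in> H) * ((1 - \<delta>) * n ^ 2 * cod u v))
      = (\<Sum>u\<in>H. \<Sum>v\<in>H-{u}. (1 - \<delta>) * n ^ 2 * cod u v)"
    using finV HV
    by (intro sum.mono_neutral_cong_right) (auto intro!: sum.mono_neutral_cong_right)
  also have "\<dots> = (1 - \<delta>) * n ^ 2 * (\<Sum>u\<in>H. \<Sum>v\<in>H-{u}. cod u v)"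
    by (simp only: sum_distrib_left)
  also have "\<dots> \<le> (1 - \<delta>) * n ^ 2 * (2 * n + 2 * (32768 / \<delta>) ^ 5)"
    using hubs \<delta> by (intro mult_left_mono) auto
  also have "(\<Sum>u\<in>V. \<Sum>v\<in>V-{u}. \<eta> * n * (deg u * cod u v + deg v * cod v u)) \<le>
      (\<Sum>u\<in>V. \<Sum>v\<in>V. \<eta> * n * (deg u * cod u v + deg v * cod v u))"
    using finV \<eta> deg_nonneg cod_nonneg by (intro sum_mono sum_mono2) auto
  also have "\<dots> = \<eta> * n * ((\<Sum>u\<in>V. \<Sum>v\<in>V. deg u * cod u v) + (\<Sum>u\<in>V. \<Sum>v\<in>V. deg v * cod v u))"
    by (simp only: sum_distrib_left sum.distrib distrib_left)
  also have "(\<Sum>u\<in>V. \<Sum>v\<in>V. deg v * cod v u) = (\<Sum>u\<in>V. \<Sum>v\<in>V. deg u * cod u v)"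
    by (rule sum.swap)
  also have "\<eta> * n * ((\<Sum>u\<in>V. \<Sum>v\<in>V. deg u * cod u v) + (\<Sum>u\<in>V. \<Sum>v\<in>V. deg u * cod u v)) \<le>
      \<eta> * n * (1024 * n ^ 2 + 1024 * n ^ 2)"
    using sum_deg_cod_le \<eta> by (intro mult_left_mono add_mono) auto
  also have "\<dots> = 2 * \<delta> * n ^ 3" by (simp add: \<eta>_def power2_eq_square power3_eq_cube)
  finally have "(\<Sum>u\<in>V. \<Sum>v\<in>V-{u}. weight u v) \<le>
      2 * \<delta> * n ^ 3 + (1 - \<delta>) * n ^ 2 * (2 * n + 2 * (32768 / \<delta>) ^ 5)" by simp
  also have "\<dots> = 2 * n ^ 3 + (1 - \<delta>) * (2 * (32768 / \<delta>) ^ 5 * n ^ 2)"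
    by (simp add: algebra_simps power2_eq_square power3_eq_cube)
  also have "\<dots> \<le> 2 * n ^ 3 + 1 * (2 * (32768 / \<delta>) ^ 5 * n ^ 2)"
    using \<delta> by (intro add_left_mono mult_right_mono) auto
  finally show ?thesis by simp
qed

text \<open>Each of the t vertices missed by the common neighbourhood \<open>X\<close> costs n^2 in
  both orders of the pair. Any third vertex has at most two neighbours in \<open>X\<close>, since it
  would form a K_{3,3} with \<open>a\<close> and \<open>b\<close>; large degrees outside the pair
  therefore come from missed vertices, and this gains only a multiple of n t^2 beyond
  O(n^2).\<close>

lemma weight_sum_dominating_pair:
  assumes a: "a \<in> V" and b: "b \<in> V" and ab: "a \<noteq> b" and \<delta>: "0 < \<delta>" "\<delta> \<le> 1 / 3400"
    and big: "(1 - \<delta>) * n ^ 2 < deg a * deg b"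
  shows "(\<Sum>u\<in>V. \<Sum>v\<in>V-{u}. weight u v) \<le> 2 * n ^ 3 + 3648 * n ^ 2"
proof -
  define V' where "V' = V - {a, b}"
  define X where "X = nb a \<inter> nb b"
  define T where "T = V' - X"
  define t where "t = real (card T)"
  have n1: "n \<ge> 1" using a finV by (simp add: Suc_le_eq card_gt_0_iff) blast
  have V_eq: "V = insert a (insert b V')" using a b by (auto simp: V'_def)
  have fin: "finite V'" "finite X" "finite T"
    using finV fin_nb by (auto simp: V'_def X_def T_def)
  have notin: "a \<notin> V'" "b \<notin> V'" by (auto simp: V'_def)
  have XV: "X \<subseteq> V'" using nb_subset irrefl by (auto simp: X_def V'_def nb_def)
  have V'_eq: "V' = X \<union> T" and XT: "X \<inter> T = {}" using XV by (auto simp: T_def)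
  have t0: "0 \<le> t" by (simp add: t_def)
  have TV: "T \<subseteq> V" by (auto simp: T_def V'_def)
  have cardV: "n = 2 + real (card X) + t"
  proof -
    have "card V = Suc (Suc (card V'))" unfolding V_eq using fin notin ab by simp
    moreover have "card V' = card X + card T" unfolding V'_eq by (rule card_Un_disjoint[OF fin(2,3) XT])
    ultimately show ?thesis by (simp add: t_def)
  qed
  have large: "(1 - \<delta>) * n < deg u" if "(1 - \<delta>) * n ^ 2 < deg u * deg v" for u v
  proof -
    have "deg u * deg v \<le> deg u * n" using deg_le deg_nonneg by (intro mult_left_mono)
    then have "(1 - \<delta>) * n * n < deg u * n" using that by (simp add: power2_eq_square)
    then show ?thesis using n1 by (simp add: mult_less_cancel_right)
  qed
  have "card (nb a) + card (nb b) = card (nb a \<union> nb b) + card X"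
    unfolding X_def by (rule card_Un_Int[OF fin_nb fin_nb])
  moreover have "card (nb a \<union> nb b) \<le> card V" using finV nb_subset by (intro card_mono) auto
  ultimately have "deg a + deg b \<le> n + real (card X)" unfolding deg_def by linarith
  moreover have "(1 - \<delta>) * n < deg a" "(1 - \<delta>) * n < deg b"
    using large[OF big] large[of b a] big by (auto simp: mult.commute)
  \<comment> \<open>Both degrees exceed (1 - \<delta>) n, so by inclusion-exclusion \<open>X\<close>
    has more than (1 - 2 \<delta>) n elements.\<close>
  ultimately have t_small: "t \<le> 2 * \<delta> * n" using cardV by (simp add: algebra_simps)
  have t_n: "t \<le> n" using cardV by simp
  have indX: "(\<Sum>v\<in>X. ind u v) \<le> 2" if "u \<in> V'" for u
  proof -
    have "card {x. adj a x \<and> adj b x \<and> adj u x} \<le> 2"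
      by (rule K33_free) (use that a b ab in \<open>auto simp: V'_def\<close>)
    moreover have "{x. adj a x \<and> adj b x \<and> adj u x} = nb u \<inter> X" by (auto simp: nb_def X_def)
    ultimately show ?thesis using card_nb_Int[OF fin(2), of u] by simp
  qed
  define dT where "dT = (\<lambda>u. \<Sum>v\<in>T. ind u v)"
  have dT0: "0 \<le> dT u" for u by (simp add: dT_def sum_nonneg ind_nonneg)
  have dTt: "dT u \<le> t" for u
    using sum_bounded_above[of T "ind u" 1] ind_le_1 by (simp add: dT_def t_def)
  have split': "(\<Sum>v\<in>V'. g v) = (\<Sum>v\<in>X. g v) + (\<Sum>v\<in>T. g v)" for g :: "'a \<Rightarrow> real"
    unfolding V'_eq using fin XT by (intro sum.union_disjoint)
  have splitV: "(\<Sum>v\<in>V. g v) = g a + g b + (\<Sum>v\<in>V'. g v)" for g :: "'a \<Rightarrow> real"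
    unfolding V_eq using fin notin ab by simp
  \<comment> \<open>The 4 consists of \<open>a\<close>, \<open>b\<close> and at most two neighbours
    in \<open>X\<close>.\<close>
  have degT: "deg u \<le> 4 + dT u" if "u \<in> V'" for u
    using indX[OF that] ind_le_1[of u a] ind_le_1[of u b] unfolding deg_eq splitV split' dT_def by linarith
  have sumTT: "(\<Sum>u\<in>T. dT u) \<le> 32 * t" unfolding dT_def t_def by (rule sum_ind_le[OF TV])
  \<comment> \<open>Counted from the side of \<open>T\<close>: at most two neighbours in
    \<open>X\<close> for each vertex, and 32 t inside \<open>T\<close>.\<close>
  have sumT: "(\<Sum>u\<in>V'. dT u) \<le> 34 * t"
  proof -
    have "(\<Sum>u\<in>V'. dT u) = (\<Sum>w\<in>T. \<Sum>u\<in>V'. ind w u)"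
      unfolding dT_def by (subst sum.swap) (simp add: ind_sym)
    also have "\<dots> \<le> (\<Sum>w\<in>T. 2 + dT w)"
      unfolding split' dT_def using indX by (intro sum_mono add_mono) (auto simp: T_def)
    also have "\<dots> = 2 * t + (\<Sum>w\<in>T. dT w)" by (simp add: sum.distrib t_def)
    finally show ?thesis using sumTT by simp
  qed
  define D where "D = (\<Sum>u\<in>V'. deg u ^ 2)"
  have D: "D \<le> 32 * n + 68 * t ^ 2"
  proof -
    have "deg u ^ 2 \<le> 32 + 2 * t * dT u" if "u \<in> V'" for u
    proof -
      have "deg u ^ 2 \<le> (4 + dT u) ^ 2" using degT[OF that] deg_nonneg by (intro power_mono)
      also have "\<dots> \<le> 32 + 2 * dT u ^ 2"
        using zero_le_power2[of "dT u - 4"] by (simp add: power2_eq_square algebra_simps)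
      also have "dT u ^ 2 \<le> t * dT u"
        unfolding power2_eq_square using dTt dT0 by (intro mult_right_mono)
      finally show ?thesis by simp
    qed
    then have "D \<le> (\<Sum>u\<in>V'. 32 + 2 * t * dT u)" unfolding D_def by (rule sum_mono)
    also have "\<dots> = 32 * real (card V') + 2 * t * (\<Sum>u\<in>V'. dT u)"
      by (simp add: sum.distrib sum_distrib_left)
    also have "\<dots> \<le> 32 * n + 2 * t * (34 * t)"
      using sumT t0 finV by (intro add_mono mult_left_mono) (auto simp: V'_def intro: card_mono)
    finally show ?thesis by (simp add: power2_eq_square)
  qed
  \<comment> \<open>The weights inside \<open>V'\<close> add up to the sum of the squares of
    \<open>s\<close>. The vertices \<open>a\<close> and \<open>b\<close> contribute 2 * (32 n)^2;
    elsewhere one factor is at most 38 t + 8 and the other sums to at most \<open>D\<close>.\<close>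
  define s where "s = (\<lambda>x. \<Sum>u\<in>V'. ind x u * deg u)"
  have s0: "0 \<le> s x" for x unfolding s_def using ind_nonneg deg_nonneg by (intro sum_nonneg) auto
  \<comment> \<open>At most two neighbours in \<open>X\<close>, each of degree at most 4 + t, and
    the whole degree sum 4 t + 32 t of \<open>T\<close>.\<close>
  have s_le: "s x \<le> 38 * t + 8" if "x \<in> V'" for x
  proof -
    have "(\<Sum>u\<in>X. ind x u * deg u) \<le> (\<Sum>u\<in>X. ind x u * (4 + t))"
    proof (intro sum_mono mult_left_mono ind_nonneg)
      fix u assume "u \<in> X"
      then show "deg u \<le> 4 + t" using degT[of u] dTt[of u] XV by auto
    qed
    also have "\<dots> = (\<Sum>u\<in>X. ind x u) * (4 + t)" by (simp only: sum_distrib_right)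
    also have "\<dots> \<le> 2 * (4 + t)" using indX[OF that] t0 by (intro mult_right_mono) auto
    finally have 1: "(\<Sum>u\<in>X. ind x u * deg u) \<le> 2 * (4 + t)" .
    have "(\<Sum>u\<in>T. ind x u * deg u) \<le> (\<Sum>u\<in>T. 4 + dT u)"
    proof (rule sum_mono)
      fix u assume "u \<in> T"
      then have "deg u \<le> 4 + dT u" using degT[of u] by (auto simp: T_def)
      moreover have "ind x u * deg u \<le> 1 * deg u" using ind_le_1 deg_nonneg by (intro mult_right_mono)
      ultimately show "ind x u * deg u \<le> 4 + dT u" by simp
    qed
    also have "\<dots> = 4 * t + (\<Sum>u\<in>T. dT u)" by (simp add: sum.distrib t_def)
    finally show ?thesis using 1 sumTT unfolding s_def split' by simp
  qed
  have s_all: "s x \<le> 32 * n" for x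
  proof -
    have "s x \<le> (\<Sum>u\<in>V'. 1 * deg u)"
      unfolding s_def using ind_le_1 deg_nonneg by (intro sum_mono mult_right_mono)
    also have "\<dots> \<le> (\<Sum>u\<in>V. deg u)" using deg_nonneg finV by (simp add: sum_mono2 V'_def)
    finally show ?thesis using sum_deg_le by simp
  qed
  have sum_s: "(\<Sum>x\<in>V'. s x) \<le> D"
  proof -
    have "(\<Sum>x\<in>V'. s x) = (\<Sum>u\<in>V'. deg u * (\<Sum>x\<in>V'. ind u x))"
      unfolding s_def by (subst sum.swap) (simp add: sum_distrib_left ind_sym mult.commute)
    also have "\<dots> \<le> (\<Sum>u\<in>V'. deg u * deg u)"
    proof (intro sum_mono mult_left_mono deg_nonneg)
      fix u show "(\<Sum>x\<in>V'. ind u x) \<le> deg u"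
        unfolding deg_eq using finV ind_nonneg by (intro sum_mono2) (auto simp: V'_def)
    qed
    finally show ?thesis by (simp add: D_def power2_eq_square)
  qed
  have rest: "(\<Sum>u\<in>V'. \<Sum>v\<in>V'. weight u v) \<le> 2048 * n ^ 2 + (38 * t + 8) * D"
  proof -
    have "(\<Sum>u\<in>V'. \<Sum>v\<in>V'. weight u v) = (\<Sum>u\<in>V'. \<Sum>v\<in>V'. \<Sum>x\<in>V. (ind x u * deg u) * (ind x v * deg v))"
      by (simp add: weight_def cod_eq sum_distrib_left mult_ac)
    also have "\<dots> = (\<Sum>u\<in>V'. \<Sum>x\<in>V. \<Sum>v\<in>V'. (ind x u * deg u) * (ind x v * deg v))"
      by (rule sum.cong[OF refl], rule sum.swap)
    also have "\<dots> = (\<Sum>x\<in>V. \<Sum>u\<in>V'. \<Sum>v\<in>V'. (ind x u * deg u) * (ind x v * deg v))" by (rule sum.swap)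
    also have "\<dots> = (\<Sum>x\<in>V. s x ^ 2)"
      by (simp only: s_def power2_eq_square sum_product)
    also have "\<dots> = s a ^ 2 + s b ^ 2 + (\<Sum>x\<in>V'. s x * s x)"
      by (simp add: splitV power2_eq_square)
    also have "\<dots> \<le> (32 * n) ^ 2 + (32 * n) ^ 2 + (\<Sum>x\<in>V'. (38 * t + 8) * s x)"
      using s_all s0 s_le by (intro add_mono power_mono sum_mono mult_right_mono)
    also have "(\<Sum>x\<in>V'. (38 * t + 8) * s x) = (38 * t + 8) * (\<Sum>x\<in>V'. s x)"
      by (simp only: sum_distrib_left)
    also have "\<dots> \<le> (38 * t + 8) * D" using sum_s t0 by (intro mult_left_mono) auto
    finally show ?thesis by (simp add: power2_eq_square)
  qed
  have hub: "(\<Sum>u\<in>V'. weight c u) \<le> n * D" for c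
  proof -
    have "weight c u \<le> n * deg u ^ 2" for u
    proof -
      have "deg c * deg u \<le> n * deg u" using deg_le deg_nonneg by (intro mult_right_mono)
      moreover have "cod c u \<le> deg u" using cod_le_deg[of u c] by (simp add: cod_sym)
      ultimately have "(deg c * deg u) * cod c u \<le> (n * deg u) * deg u"
        by (rule mult_mono) (simp_all add: deg_nonneg cod_nonneg)
      then show ?thesis by (simp add: weight_def power2_eq_square mult.assoc)
    qed
    then show ?thesis unfolding D_def sum_distrib_left by (intro sum_mono)
  qed
  have main: "weight a b \<le> n ^ 2 * (n - t)"
  proof -
    have "deg a * deg b \<le> n * n" using deg_le deg_nonneg by (intro mult_mono) auto
    moreover have "cod a b \<le> n - t" using cardV by (simp add: cod_def X_def)
    ultimately show ?thesis unfolding weight_def power2_eq_square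
      by (rule mult_mono) (simp_all add: cod_nonneg)
  qed
  have "(\<Sum>u\<in>V. \<Sum>v\<in>V-{u}. weight u v) =
      (\<Sum>v\<in>V-{a}. weight a v) + (\<Sum>v\<in>V-{b}. weight b v) + (\<Sum>u\<in>V'. \<Sum>v\<in>V-{u}. weight u v)"
    by (rule splitV)
  also have "(\<Sum>v\<in>V-{a}. weight a v) = weight a b + (\<Sum>v\<in>V'. weight a v)"
  proof -
    have "V - {a} = insert b V'" using V_eq notin ab by auto
    then show ?thesis using fin notin by simp
  qed
  also have "(\<Sum>v\<in>V-{b}. weight b v) = weight a b + (\<Sum>v\<in>V'. weight b v)"
  proof -
    have "V - {b} = insert a V'" using V_eq notin ab by auto
    then show ?thesis using fin notin by (simp add: weight_sym)
  qed
  also have "(\<Sum>u\<in>V'. \<Sum>v\<in>V-{u}. weight u v) \<le> (\<Sum>u\<in>V'. \<Sum>v\<in>V. weight u v)"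
    using finV weight_nonneg by (intro sum_mono sum_mono2) auto
  also have "\<dots> = (\<Sum>v\<in>V'. weight a v) + (\<Sum>v\<in>V'. weight b v) + (\<Sum>u\<in>V'. \<Sum>v\<in>V'. weight u v)"
    unfolding splitV sum.distrib by (simp add: weight_sym)
  finally have "(\<Sum>u\<in>V. \<Sum>v\<in>V-{u}. weight u v) \<le> 2 * weight a b + 2 * (\<Sum>v\<in>V'. weight a v)
      + 2 * (\<Sum>v\<in>V'. weight b v) + (\<Sum>u\<in>V'. \<Sum>v\<in>V'. weight u v)" by simp
  also have "\<dots> \<le> 2 * (n ^ 2 * (n - t)) + 2 * (n * D) + 2 * (n * D) + (2048 * n ^ 2 + (38 * t + 8) * D)"
    using main hub rest by (intro add_mono mult_left_mono) auto
  also have "\<dots> = 2 * n ^ 2 * (n - t) + 2048 * n ^ 2 + (4 * n + 38 * t + 8) * D"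
    by (simp add: algebra_simps)
  \<comment> \<open>Since t <= n and 1 <= n, 4 n + 38 t + 8 <= 50 n. Then 3648 = 2048 + 50 * 32 and
    3400 = 50 * 68.\<close>
  also have "\<dots> \<le> 2 * n ^ 2 * (n - t) + 2048 * n ^ 2 + (50 * n) * (32 * n + 68 * t ^ 2)"
    using D t_n n1 t0 by (intro add_left_mono mult_mono) (auto simp: D_def intro: sum_nonneg)
  also have "\<dots> = 2 * n ^ 3 + 3648 * n ^ 2 + n * t * (3400 * t - 2 * n)"
    by (simp add: algebra_simps power2_eq_square power3_eq_cube)
  also have "\<dots> \<le> 2 * n ^ 3 + 3648 * n ^ 2"
  proof -
    have "\<delta> * n \<le> 1 / 3400 * n" using \<delta>(2) n1 by (intro mult_right_mono) auto
    then have "3400 * t - 2 * n \<le> 0" using t_small by simp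
    then have "n * t * (3400 * t - 2 * n) \<le> 0" using n1 t0 by (intro mult_nonneg_nonpos) auto
    then show ?thesis by simp
  qed
  finally show ?thesis .
qed

text \<open>Both cases apply with \<delta> = 1/3400; the constant is that of the first case, which
  far exceeds 3648.\<close>

lemma weight_sum_le:
  "(\<Sum>u\<in>V. \<Sum>v\<in>V-{u}. weight u v) \<le> 2 * n ^ 3 + 2 * (32768 * 3400) ^ 5 * n ^ 2"
proof (cases "V = {}")
  case False
  show ?thesis
  proof (cases "\<exists>a\<in>V. \<exists>b\<in>V. a \<noteq> b \<and> (1 - 1 / 3400) * n ^ 2 < deg a * deg b")
    case True
    then obtain a b where "a \<in> V" "b \<in> V" "a \<noteq> b" "(1 - 1 / 3400) * n ^ 2 < deg a * deg b" by auto
    then have "(\<Sum>u\<in>V. \<Sum>v\<in>V-{u}. weight u v) \<le> 2 * n ^ 3 + 3648 * n ^ 2"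
      by (intro weight_sum_dominating_pair[of a b "1 / 3400"]) auto
    also have "\<dots> \<le> 2 * n ^ 3 + 2 * (32768 * 3400) ^ 5 * n ^ 2"
      by (intro add_left_mono mult_right_mono) auto
    finally show ?thesis .
  next
    case no: False
    have "(\<Sum>u\<in>V. \<Sum>v\<in>V-{u}. weight u v) \<le> 2 * n ^ 3 + 2 * (32768 / (1 / 3400)) ^ 5 * n ^ 2"
      using no by (intro weight_sum_no_dominating_pair[OF False]) (auto simp: not_less)
    then show ?thesis by simp
  qed
qed simp

end

section \<open>Copies of the path\<close>

lemma finite_P4_copies: "finite E \<Longrightarrow> finite (P4_copies E)"
  by (rule finite_subset[of _ "Pow E"]) (auto simp: P4_copies_def)

lemma simple_graph_subset: "simple_graph n E \<Longrightarrow> E \<subseteq> Pow {0..<n}"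
  unfolding simple_graph_def by fastforce

lemma finite_planar_counts: "finite {card (P4_copies E) | E. simple_graph n E \<and> planar n E}"
  by (rule finite_subset[of _ "(card \<circ> P4_copies) ` Pow (Pow {0..<n})"])
    (use simple_graph_subset in \<open>fastforce\<close>, simp)

lemma (in plane_graph) sparse_graph: "sparse_graph {0..<n} (\<lambda>u v. {u, v} \<in> E)"
proof
  fix a b c assume "a \<in> {0..<n}" "b \<in> {0..<n}" "c \<in> {0..<n}" "a \<noteq> b" "a \<noteq> c" "b \<noteq> c"
  then show "card {x. {a, x} \<in> E \<and> {b, x} \<in> E \<and> {c, x} \<in> E} \<le> 2"
    by (intro few_common_neighbours) auto
next
  fix u v assume "{u, v} \<in> E"
  then show "u \<in> {0..<n}" "{v, u} \<in> E" using edge_subset[of "{u, v}"] by (auto simp: insert_commute)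
qed (use few_edges not_edge_loop in auto)

text \<open>The vertex type of the locale carries no order, so the relation selecting one of (u, v)
  and (v, u) is a parameter.\<close>

lemma (in sparse_graph) sum_weight_ordered:
  fixes lt :: "'a \<Rightarrow> 'a \<Rightarrow> bool"
  assumes tot: "\<And>u v. u \<noteq> v \<Longrightarrow> lt u v \<or> lt v u" and asym: "\<And>u v. lt u v \<Longrightarrow> \<not> lt v u"
  shows "(\<Sum>u\<in>V. \<Sum>v\<in>V-{u}. weight u v) = 2 * (\<Sum>(u, v)\<in>{(u, v). u \<in> V \<and> v \<in> V \<and> lt u v}. weight u v)"
proof -
  let ?P = "{(u, v). u \<in> V \<and> v \<in> V \<and> lt u v}" and ?Q = "{(u, v). u \<in> V \<and> v \<in> V \<and> lt v u}"
  have fin: "finite ?P" "finite ?Q"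
    by (rule finite_subset[of _ "V \<times> V"]; use finV in auto)+
  have "(\<Sum>u\<in>V. \<Sum>v\<in>V-{u}. weight u v) = (\<Sum>(u, v)\<in>(SIGMA u:V. V - {u}). weight u v)"
    using finV by (subst sum.Sigma) auto
  also have "(SIGMA u:V. V - {u}) = ?P \<union> ?Q" using tot asym by auto
  also have "(\<Sum>(u, v)\<in>?P \<union> ?Q. weight u v) = (\<Sum>(u, v)\<in>?P. weight u v) + (\<Sum>(u, v)\<in>?Q. weight u v)"
    using fin asym by (intro sum.union_disjoint) auto
  also have "(\<Sum>(u, v)\<in>?Q. weight u v) = (\<Sum>(u, v)\<in>?P. weight u v)"
    by (rule sum.reindex_bij_witness[of _ prod.swap prod.swap]) (auto simp: weight_sym)
  finally show ?thesis by simp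
qed

text \<open>The map from tuples to edge sets only has to cover the copies, so tuples with coinciding
  vertices may stay. Ordering the second and fourth vertex halves the weight sum and removes the
  factor 2.\<close>

lemma card_P4_copies_le:
  assumes "simple_graph n E" "planar n E"
  shows "real (card (P4_copies E)) \<le> real n ^ 3 + (32768 * 3400) ^ 5 * real n ^ 2"
proof -
  obtain pos curve where "plane_graph n E pos curve"
    using planar_imp_plane_graph[OF assms] by metis
  then interpret plane_graph n E pos curve .
  interpret G: sparse_graph "{0..<n}" "\<lambda>u v. {u, v} \<in> E" by (rule sparse_graph)
  let ?P = "{(u, v). u \<in> {0..<n} \<and> v \<in> {0..<n} \<and> u < v}"
  let ?T = "SIGMA p:?P. G.nb (fst p) \<times> (G.nb (fst p) \<inter> G.nb (snd p)) \<times> G.nb (snd p)"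
  let ?\<phi> = "\<lambda>((v1, v3), (v0, v2, v4)). {{v0, v1}, {v1, v2}, {v2, v3}, {v3, v4}}"
  have finP: "finite ?P" by (rule finite_subset[of _ "{0..<n} \<times> {0..<n}"]) auto
  have finT: "finite ?T" using finP G.fin_nb by (intro finite_SigmaI) auto
  have "P4_copies E \<subseteq> ?\<phi> ` ?T"
  proof
    fix S assume "S \<in> P4_copies E"
    then obtain v0 v1 v2 v3 v4 where S: "S = {{v0, v1}, {v1, v2}, {v2, v3}, {v3, v4}}"
      and d: "distinct [v0, v1, v2, v3, v4]"
      and E: "{v0, v1} \<in> E" "{v1, v2} \<in> E" "{v2, v3} \<in> E" "{v3, v4} \<in> E"
      unfolding P4_copies_def by blast
    have V: "v1 < n" "v3 < n" using edge_subset[OF E(1)] edge_subset[OF E(4)] by auto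
    have E': "{v1, v0} \<in> E" "{v2, v1} \<in> E" "{v3, v2} \<in> E" "{v4, v3} \<in> E" using E by (simp_all add: insert_commute)
    \<comment> \<open>A path can be read from either end; one of the readings has the smaller of the
      two inner vertices in second place.\<close>
    show "S \<in> ?\<phi> ` ?T"
    proof (cases "v1 < v3")
      case True
      then show ?thesis using V E E' S
        by (intro image_eqI[of _ _ "((v1, v3), (v0, v2, v4))"]) (auto simp: G.nb_def)
    next
      case False
      moreover have "v1 \<noteq> v3" using d by simp
      ultimately have "v3 < v1" by simp
      moreover have "S = {{v4, v3}, {v3, v2}, {v2, v1}, {v1, v0}}" unfolding S by (auto simp: insert_commute)
      ultimately show ?thesis using V E E'
        by (intro image_eqI[of _ _ "((v3, v1), (v4, v2, v0))"]) (auto simp: G.nb_def)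
    qed
  qed
  then have "card (P4_copies E) \<le> card ?T"
    using surj_card_le[OF finT] by blast
  also have "card ?T = (\<Sum>p\<in>?P. card (G.nb (fst p)) * (card (G.nb (fst p) \<inter> G.nb (snd p)) * card (G.nb (snd p))))"
    using finP G.fin_nb by (subst card_SigmaI) (auto simp: card_cartesian_product)
  finally have "real (card (P4_copies E)) \<le> real (\<Sum>p\<in>?P. card (G.nb (fst p)) * (card (G.nb (fst p) \<inter> G.nb (snd p)) * card (G.nb (snd p))))"
    by (simp only: of_nat_le_iff)
  also have "\<dots> = (\<Sum>(u, v)\<in>?P. G.weight u v)"
    by (simp add: G.weight_def G.deg_def G.cod_def case_prod_beta' mult_ac)
  finally have "real (card (P4_copies E)) \<le> (\<Sum>(u, v)\<in>?P. G.weight u v)" .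
  moreover have "2 * (\<Sum>(u, v)\<in>?P. G.weight u v) = (\<Sum>u\<in>{0..<n}. \<Sum>v\<in>{0..<n}-{u}. G.weight u v)"
    by (rule G.sum_weight_ordered[symmetric]) auto
  moreover have "(\<Sum>u\<in>{0..<n}. \<Sum>v\<in>{0..<n}-{u}. G.weight u v)
      \<le> 2 * real (card {0..<n}) ^ 3 + 2 * (32768 * 3400) ^ 5 * real (card {0..<n}) ^ 2"
    by (rule G.weight_sum_le)
  ultimately show ?thesis unfolding card_atLeastLessThan by simp
qed

section \<open>Lower bound: straight-line drawing of K_{2,n-2}\<close>

definition K2_edges :: "nat \<Rightarrow> nat set set" where
  "K2_edges n = {{i, j} | i j. i < 2 \<and> 2 \<le> j \<and> j < n}"

lemma simple_K2_edges: "simple_graph n (K2_edges n)"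
  unfolding simple_graph_def
proof
  fix e assume "e \<in> K2_edges n"
  then obtain i j where "i < 2" "2 \<le> j" "j < n" "e = {i, j}" by (auto simp: K2_edges_def)
  then show "\<exists>u v. u \<noteq> v \<and> u < n \<and> v < n \<and> e = {u, v}"
    by (intro exI[of _ i] exI[of _ j]) auto
qed

text \<open>Hubs at heights 1 and -1, all other vertices on the positive horizontal axis: the height
  of a point tells how far along its segment it lies.\<close>

definition K2_pos :: "nat \<Rightarrow> real \<times> real" where
  "K2_pos i = (if i = 0 then (0, 1) else if i = 1 then (0, - 1) else (real i, 0))"

lemma K2_segment:
  assumes "i < 2" "2 \<le> j" "z \<in> closed_segment (K2_pos i) (K2_pos j)"
  obtains t where "0 \<le> t" "t \<le> 1" "z = (t * real j, (1 - t) * (if i = 0 then 1 else - 1))"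
  using assms by (auto simp: closed_segment_def K2_pos_def)

lemma inj_K2_pos: "inj K2_pos"
  by (auto simp: inj_def K2_pos_def split: if_splits)

lemma K2_segment_vertex:
  assumes "i < 2" "2 \<le> j" "K2_pos k \<in> closed_segment (K2_pos i) (K2_pos j)"
  shows "k = i \<or> k = j"
proof -
  obtain t where t: "0 \<le> t" "t \<le> 1" "K2_pos k = (t * real j, (1 - t) * (if i = 0 then 1 else - 1))"
    using K2_segment[OF assms] by blast
  have "i = 0 \<or> i = 1" using assms by auto
  then show ?thesis using t assms by (auto simp: K2_pos_def split: if_splits)
qed

text \<open>The absolute height is 1 - t on every segment, so a common point has equal parameters.
  At t = 1 the abscissa identifies the end; for t < 1 the sign of the height fixes the hub, and
  different ends then force t = 0.\<close>

lemma K2_segments_meet: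
  assumes "i < 2" "2 \<le> j" "i' < 2" "2 \<le> j'" "{i, j} \<noteq> {i', j'}"
    and z: "z \<in> closed_segment (K2_pos i) (K2_pos j)" "z \<in> closed_segment (K2_pos i') (K2_pos j')"
  shows "z \<in> K2_pos ` ({i, j} \<inter> {i', j'})"
proof -
  let ?h = "\<lambda>i::nat. if i = 0 then 1 else - 1 :: real"
  obtain t where t: "0 \<le> t" "t \<le> 1" "z = (t * real j, (1 - t) * ?h i)"
    using K2_segment[OF assms(1,2) z(1)] by blast
  obtain t' where t': "0 \<le> t'" "t' \<le> 1" "z = (t' * real j', (1 - t') * ?h i')"
    using K2_segment[OF assms(3,4) z(2)] by blast
  have eq: "t * real j = t' * real j'" "(1 - t) * ?h i = (1 - t') * ?h i'" using t(3) t'(3) by auto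
  have i01: "i = 0 \<or> i = 1" "i' = 0 \<or> i' = 1" using assms by auto
  have tt: "t = t'" using eq(2) t t' i01 by (auto split: if_splits)
  show ?thesis
  proof (cases "t = 1")
    case True
    then have "j = j'" "z = K2_pos j" using eq tt t(3) assms by (auto simp: K2_pos_def)
    then show ?thesis by auto
  next
    case False
    then have ii: "i = i'" using eq(2) tt t i01 by (auto split: if_splits)
    then have "j \<noteq> j'" using assms(5) by auto
    then have "t = 0" using eq(1) tt by auto
    then have "z = K2_pos i" using t(3) i01 by (auto simp: K2_pos_def)
    then show ?thesis using ii by auto
  qed
qed

lemma planar_K2_edges: "planar n (K2_edges n)"
  unfolding planar_def
proof (intro exI conjI ballI impI)
  \<comment> \<open>\<open>Min e\<close> is the hub and \<open>Max e\<close> the other vertex, so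
    the curve depends on the edge alone.\<close>
  let ?c = "\<lambda>e. linepath (K2_pos (Min e)) (K2_pos (Max e))"
  have Ee: "\<exists>i j. i < 2 \<and> 2 \<le> j \<and> j < n \<and> e = {i, j} \<and> ?c e = linepath (K2_pos i) (K2_pos j)"
    if "e \<in> K2_edges n" for e
  proof -
    from that obtain i j where ij: "i < 2" "2 \<le> j" "j < n" "e = {i, j}" by (auto simp: K2_edges_def)
    then have "Min e = i" "Max e = j" by (auto simp: min_def max_def)
    then show ?thesis using ij by auto
  qed
  show "inj_on K2_pos {0..<n}" using inj_K2_pos by (rule inj_on_subset) simp
  fix e assume e: "e \<in> K2_edges n"
  obtain i j where ij: "i < 2" "2 \<le> j" "j < n" "e = {i, j}" "?c e = linepath (K2_pos i) (K2_pos j)"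
    using Ee[OF e] by blast
  have "K2_pos i \<noteq> K2_pos j" using inj_K2_pos ij by (auto dest: injD)
  then show "arc (?c e)" unfolding ij(5) by (rule arc_linepath)
  show "{pathstart (?c e), pathfinish (?c e)} = K2_pos ` e" unfolding ij(5) unfolding ij(4) by simp
  show "path_image (?c e) \<inter> K2_pos ` {0..<n} = K2_pos ` e"
    unfolding ij(5) unfolding ij(4) path_image_linepath
  proof
    show "closed_segment (K2_pos i) (K2_pos j) \<inter> K2_pos ` {0..<n} \<subseteq> K2_pos ` {i, j}"
      using K2_segment_vertex[OF ij(1,2)] by blast
    show "K2_pos ` {i, j} \<subseteq> closed_segment (K2_pos i) (K2_pos j) \<inter> K2_pos ` {0..<n}"
      using ij by auto
  qed
  fix e' assume e': "e' \<in> K2_edges n" and ne: "e \<noteq> e'"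
  obtain i' j' where ij': "i' < 2" "2 \<le> j'" "e' = {i', j'}" "?c e' = linepath (K2_pos i') (K2_pos j')"
    using Ee[OF e'] by blast
  show "path_image (?c e) \<inter> path_image (?c e') \<subseteq> K2_pos ` (e \<inter> e')"
    unfolding ij(5) ij'(4) path_image_linepath
    using K2_segments_meet[OF ij(1,2) ij'(1,2)] ne unfolding ij(4) ij'(3) by blast
qed

lemma card_distinct_triples:
  assumes "finite L"
  shows "card (SIGMA x:L. SIGMA y:L - {x}. L - {x, y}) = card L * ((card L - 1) * (card L - 2))"
proof -
  have "card (L - {x, y}) = card L - 2" if "x \<in> L" "y \<in> L - {x}" for x y
    using that assms by (subst card_Diff_subset) auto
  then have "card (SIGMA y:L - {x}. L - {x, y}) = (card L - 1) * (card L - 2)" if "x \<in> L" for x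
    using that assms by (subst card_SigmaI) auto
  then show ?thesis using assms by (subst card_SigmaI) auto
qed

text \<open>Counts the paths x, 0, y, 1, z. The edge set determines y as the common neighbour of 0
  and 1 in it, and then x and z.\<close>

lemma card_P4_copies_K2: "(n - 2) * ((n - 3) * (n - 4)) \<le> card (P4_copies (K2_edges n))"
proof -
  let ?L = "{2..<n}"
  let ?T = "SIGMA x:?L. SIGMA y:?L - {x}. ?L - {x, y}"
  let ?\<phi> = "\<lambda>(x, y, z). {{x, 0}, {0, y}, {y, 1}, {1, z :: nat}}"
  have "inj_on ?\<phi> ?T"
  proof (rule inj_onI)
    fix p q assume pq: "p \<in> ?T" "q \<in> ?T" and \<phi>: "?\<phi> p = ?\<phi> q"
    obtain x y z x' y' z' where p: "p = (x, y, z)" "q = (x', y', z')" by (metis prod_cases3)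
    have h: "x \<in> ?L" "y \<in> ?L" "z \<in> ?L" "x' \<in> ?L" "y' \<in> ?L" "z' \<in> ?L"
      and d: "y \<noteq> x" "z \<notin> {x, y}" "y' \<noteq> x'" "z' \<notin> {x', y'}"
      using pq unfolding p by auto
    have eq: "{{x, 0}, {0, y}, {y, 1}, {1, z}} = {{x', 0}, {0, y'}, {y', 1}, {1, z'}}"
      using \<phi> unfolding p by simp
    have g: "x > 1" "y > 1" "z > 1" "x' > 1" "y' > 1" "z' > 1" using h by auto
    have m0: "w = x' \<or> w = y'" if "{0, w} \<in> {{x', 0}, {0, y'}, {y', 1}, {1, z'}}" "w > 1" for w
      using that g by (auto simp: doubleton_eq_iff)
    have m1: "w = y' \<or> w = z'" if "{1, w} \<in> {{x', 0}, {0, y'}, {y', 1}, {1, z'}}" "w > 1" for w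
      using that g by (auto simp: doubleton_eq_iff)
    have F: "{0, y} \<in> {{x, 0}, {0, y}, {y, 1}, {1, z}}" "{1, y} \<in> {{x, 0}, {0, y}, {y, 1}, {1, z}}"
      "{0, x} \<in> {{x, 0}, {0, y}, {y, 1}, {1, z}}" "{1, z} \<in> {{x, 0}, {0, y}, {y, 1}, {1, z}}"
      by (auto simp: insert_commute)
    note F = F[unfolded eq]
    have "y = x' \<or> y = y'" "y = y' \<or> y = z'" "x = x' \<or> x = y'" "z = y' \<or> z = z'"
      by (rule m0[OF F(1) g(2)], rule m1[OF F(2) g(2)], rule m0[OF F(3) g(1)], rule m1[OF F(4) g(3)])
    then show "p = q" using d unfolding p by auto
  qed
  moreover have "?\<phi> ` ?T \<subseteq> P4_copies (K2_edges n)"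
  proof
    fix S assume "S \<in> ?\<phi> ` ?T"
    then obtain p where p: "p \<in> ?T" "S = ?\<phi> p" by blast
    obtain x y z where xyz: "p = (x, y, z)" by (metis prod_cases3)
    have S: "S = {{x, 0}, {0, y}, {y, 1}, {1, z}}" using p(2) unfolding xyz by simp
    have L: "x \<in> ?L" "y \<in> ?L" "z \<in> ?L" "x \<noteq> y" "x \<noteq> z" "y \<noteq> z"
      using p(1) unfolding xyz by auto
    have E: "{i, w} \<in> K2_edges n" "{w, i} \<in> K2_edges n" if "i < 2" "w \<in> ?L" for i w
      using that by (auto simp: K2_edges_def insert_commute)
    show "S \<in> P4_copies (K2_edges n)"
      unfolding P4_copies_def
    proof (rule CollectI, intro exI conjI)
      show "S = {{x, 0}, {0, y}, {y, 1}, {1, z}}" by (rule S)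
      show "distinct [x, 0, y, 1, z]" using L by auto
    qed (rule E; use L in simp)+
  qed
  moreover have "finite (P4_copies (K2_edges n))"
    using simple_graph_subset[OF simple_K2_edges] by (intro finite_P4_copies) (meson finite_Pow_iff finite_atLeastLessThan finite_subset)
  ultimately have "card ?T \<le> card (P4_copies (K2_edges n))" by (rule card_inj_on_le)
  then show ?thesis by (simp add: card_distinct_triples)
qed

theorem theorem4:
  shows "\<exists>C::real. \<forall>n::nat. n \<ge> 1 \<longrightarrow>
           \<bar>real (f_P4 n) - real n ^ 3\<bar> \<le> C * real n ^ 2"
proof (intro exI[of _ "(32768 * 3400) ^ 5"] allI impI)
  fix n :: nat assume n: "n \<ge> 1"
  let ?A = "{card (P4_copies E) | E. simple_graph n E \<and> planar n E}"
  have in_A: "card (P4_copies (K2_edges n)) \<in> ?A" using simple_K2_edges planar_K2_edges by blast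
  have "f_P4 n \<in> ?A"
    unfolding f_P4_def using finite_planar_counts in_A by (intro Max_in) auto
  then have up: "real (f_P4 n) \<le> real n ^ 3 + (32768 * 3400) ^ 5 * real n ^ 2"
    using card_P4_copies_le by auto
  have "card (P4_copies (K2_edges n)) \<le> f_P4 n"
    unfolding f_P4_def using finite_planar_counts in_A by (intro Max_ge)
  then have low: "(n - 2) * ((n - 3) * (n - 4)) \<le> f_P4 n" using card_P4_copies_K2[of n] by linarith
  \<comment> \<open>The coefficient 9 = 2 + 3 + 4 comes from expanding (n - 2)(n - 3)(n - 4). For n
    < 4 truncated subtraction blocks the passage to the reals, but there n^3 <= 9 n^2
    already.\<close>
  have "real n ^ 3 - 9 * real n ^ 2 \<le> real (f_P4 n)"
  proof (cases "n < 4")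
    case True
    then have "real n * real n ^ 2 \<le> 9 * real n ^ 2" by (intro mult_right_mono) auto
    then have "real n ^ 3 \<le> 9 * real n ^ 2" by (simp add: power3_eq_cube power2_eq_square)
    then show ?thesis by simp
  next
    case False
    have "real n ^ 3 - 9 * real n ^ 2 \<le> (real n - 2) * ((real n - 3) * (real n - 4))"
      using False by (simp add: algebra_simps power3_eq_cube power2_eq_square)
    also have "\<dots> = real ((n - 2) * ((n - 3) * (n - 4)))" using False by (simp add: of_nat_diff)
    also have "\<dots> \<le> real (f_P4 n)" using low by (simp only: of_nat_le_iff)
    finally show ?thesis .
  qed
  moreover have "9 * real n ^ 2 \<le> (32768 * 3400) ^ 5 * real n ^ 2" by (intro mult_right_mono) auto
  ultimately show "\<bar>real (f_P4 n) - real n ^ 3\<bar> \<le> (32768 * 3400) ^ 5 * real n ^ 2"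
    using up unfolding abs_le_iff by linarith
qed

end
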